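(* Let $(M^n,g,\nabla,T)$ be an $n$-dimensional Riemannian spin manifold with a metric connection $\nabla$ of totally skew-symmetric torsion $T$, and let $D$ be the Dirac operator of $\nabla$. Then for any spinor field $\Psi$ the formula $$D^2\Psi=\nabla^*\nabla\Psi+\frac34\,dT\cdot\Psi-\frac12\,\sigma^T\cdot\Psi+\frac12\,\delta^g(T)\cdot\Psi-\sum_{k=1}^n (e_k\lrcorner T)\cdot\nabla_{e_k}\Psi+\frac14\,\mathrm{Scal}^{\nabla}\cdot\Psi$$ holds, where $e_1,\dots,e_n$ is a local orthonormal frame and $\nabla^*\nabla$ is the Laplacian of $\nabla$ acting on spinors by $$\nabla^*\nabla\Psi=\sum_{i=1}^n\Big(-\nabla_{e_i}\nabla_{e_i}\Psi+\nabla_{\nabla^g_{e_i}e_i}\Psi\Big).$$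
   Context: $\nabla^g$ is the Levi-Civita connection. A metric connection $\nabla$ has totally skew-symmetric torsion $T$ if $T(X,Y,Z):=g(T(X,Y),Z)$ is a $3$-form, where $T(X,Y)=\nabla_XY-\nabla_YX-[X,Y]$; equivalently $g(\nabla_XY,Z)=g(\nabla^g_XY,Z)+\frac12T(X,Y,Z)$. The induced connection on the spinor bundle is also denoted $\nabla$. Vectors and covectors are identified by $g$; $\lrcorner$ is interior product. Clifford multiplication satisfies $X\cdot X=-g(X,X)$, and for an orthonormal frame and distinct indices the form $e_{i_1}\wedge\dots\wedge e_{i_p}$ acts on spinors as $e_{i_1}\cdots e_{i_p}$. The Dirac operator of $\nabla$ is $D\Psi=\sum_i e_i\cdot\nabla_{e_i}\Psi$. The form conventions are $d\alpha=\sum_i e_i\wedge\nabla^g_{e_i}\alpha$ and $\delta^g\alpha=-\sum_i e_i\lrcorner\nabla^g_{e_i}\alpha$. The $4$-form $\sigma^T$ is $\sigma^T=\frac12\sum_i(e_i\lrcorner T)\wedge(e_i\lrcorner T)$, i.e. $\sigma^T(X,Y,Z,V)=g(T(X,Y),T(Z,V))+g(T(Y,Z),T(X,V))+g(T(Z,X),T(Y,V))$. With $R^\nabla(X,Y,Z,V)=g(R^\nabla(X,Y)Z,V)$, where $R^\nabla(X,Y)=[\nabla_X,\nabla_Y]-\nabla_{[X,Y]}$, the scalar curvature of $\nabla$ is $\mathrm{Scal}^\nabla=\sum_{i,j}R^\nabla(e_i,e_j,e_j,e_i)$. *)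

theory Defs
  imports "HOL-Analysis.Analysis"
begin

section \<open>Smooth manifolds\<close>

primrec Ck_on :: "nat \<Rightarrow> 'a::real_normed_vector set \<Rightarrow> ('a \<Rightarrow> 'b::real_normed_vector) \<Rightarrow> bool" where
  "Ck_on 0 S f \<longleftrightarrow> continuous_on S f"
| "Ck_on (Suc k) S f \<longleftrightarrow>
     (\<forall>x\<in>S. f differentiable (at x)) \<and>
     (\<forall>v. Ck_on k S (\<lambda>x. frechet_derivative f (at x) v))"

text \<open>Used for open \<open>S\<close> only.\<close>
definition Cinf_on :: "'a::real_normed_vector set \<Rightarrow> ('a \<Rightarrow> 'b::real_normed_vector) \<Rightarrow> bool" where
  "Cinf_on S f \<longleftrightarrow> (\<forall>k. Ck_on k S f)"

text \<open>The manifold is the whole type \<open>'m\<close>, of dimension \<open>CARD('n)\<close>. A chart is a pair of its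
  domain and its coordinate map; the atlas need not be maximal.\<close>

type_synonym ('m, 'n) atlas = "('m set \<times> ('m \<Rightarrow> real ^ 'n)) set"

definition smooth_atlas :: "('m::topological_space, 'n::finite) atlas \<Rightarrow> bool" where
  "smooth_atlas \<A> \<longleftrightarrow>
     (\<Union>(V, \<phi>)\<in>\<A>. V) = UNIV \<and>
     (\<forall>(V, \<phi>)\<in>\<A>. open V \<and> open (\<phi> ` V) \<and> homeomorphism V (\<phi> ` V) \<phi> (inv_into V \<phi>)) \<and>
     (\<forall>(V, \<phi>)\<in>\<A>. \<forall>(V', \<phi>')\<in>\<A>. Cinf_on (\<phi> ` (V \<inter> V')) (\<phi>' \<circ> inv_into V \<phi>))"

definition smooth_fun ::
  "('m::topological_space, 'n::finite) atlas \<Rightarrow> 'm set \<Rightarrow> ('m \<Rightarrow> 'b::real_normed_vector) \<Rightarrow> bool" where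
  "smooth_fun \<A> U f \<longleftrightarrow>
     open U \<and> (\<forall>(V, \<phi>)\<in>\<A>. Cinf_on (\<phi> ` (U \<inter> V)) (f \<circ> inv_into V \<phi>))"

definition smooth_at :: "('m::topological_space, 'n::finite) atlas \<Rightarrow> 'm \<Rightarrow> ('m \<Rightarrow> real) \<Rightarrow> bool" where
  "smooth_at \<A> p f \<longleftrightarrow> (\<exists>U. p \<in> U \<and> smooth_fun \<A> U f)"

section \<open>Tangent vectors and vector fields\<close>

text \<open>Tangent vectors at \<open>p\<close> are the derivations of germs at \<open>p\<close> of smooth functions. They are
  represented by functionals on all functions which vanish on those not smooth near \<open>p\<close>, so that
  equality of functionals is equality of tangent vectors.\<close>

type_synonym 'm tvec = "('m \<Rightarrow> real) \<Rightarrow> real"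
type_synonym 'm vfield = "'m \<Rightarrow> 'm tvec"

definition tangent :: "('m::topological_space, 'n::finite) atlas \<Rightarrow> 'm \<Rightarrow> 'm tvec \<Rightarrow> bool" where
  "tangent \<A> p v \<longleftrightarrow>
     (\<forall>f h a b. smooth_at \<A> p f \<and> smooth_at \<A> p h \<longrightarrow>
        v (\<lambda>q. a * f q + b * h q) = a * v f + b * v h) \<and>
     (\<forall>f h. smooth_at \<A> p f \<and> smooth_at \<A> p h \<longrightarrow>
        v (\<lambda>q. f q * h q) = v f * h p + f p * v h) \<and>
     (\<forall>f h. smooth_at \<A> p f \<and> (\<forall>\<^sub>F q in nhds p. f q = h q) \<longrightarrow> v f = v h) \<and>
     (\<forall>f. \<not> smooth_at \<A> p f \<longrightarrow> v f = 0)"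

definition vadd :: "'m tvec \<Rightarrow> 'm tvec \<Rightarrow> 'm tvec" where
  "vadd v w = (\<lambda>f. v f + w f)"

definition vscale :: "real \<Rightarrow> 'm tvec \<Rightarrow> 'm tvec" where
  "vscale a v = (\<lambda>f. a * v f)"

definition vfield_on ::
  "('m::topological_space, 'n::finite) atlas \<Rightarrow> 'm set \<Rightarrow> 'm vfield \<Rightarrow> bool" where
  "vfield_on \<A> U X \<longleftrightarrow>
     open U \<and> (\<forall>p\<in>U. tangent \<A> p (X p)) \<and>
     (\<forall>V f. V \<subseteq> U \<and> smooth_fun \<A> V f \<longrightarrow> smooth_fun \<A> V (\<lambda>p. X p f))"

definition lie_bracket ::
  "('m::topological_space, 'n::finite) atlas \<Rightarrow> 'm vfield \<Rightarrow> 'm vfield \<Rightarrow> 'm vfield" where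
  "lie_bracket \<A> X Y =
     (\<lambda>p f. if smooth_at \<A> p f then X p (\<lambda>q. Y q f) - Y p (\<lambda>q. X q f) else 0)"

section \<open>Riemannian metrics, connections, differential forms\<close>

definition riemannian_metric ::
  "('m::topological_space, 'n::finite) atlas \<Rightarrow> ('m \<Rightarrow> 'm tvec \<Rightarrow> 'm tvec \<Rightarrow> real) \<Rightarrow> bool" where
  "riemannian_metric \<A> g \<longleftrightarrow>
     (\<forall>p v w. tangent \<A> p v \<and> tangent \<A> p w \<longrightarrow> g p v w = g p w v) \<and>
     (\<forall>p u v w a b. tangent \<A> p u \<and> tangent \<A> p v \<and> tangent \<A> p w \<longrightarrow>
        g p (vadd (vscale a u) (vscale b v)) w = a * g p u w + b * g p v w) \<and>
     (\<forall>p v. tangent \<A> p v \<and> v \<noteq> (\<lambda>f. 0) \<longrightarrow> 0 < g p v v) \<and>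
     (\<forall>U X Y. vfield_on \<A> U X \<and> vfield_on \<A> U Y \<longrightarrow> smooth_fun \<A> U (\<lambda>p. g p (X p) (Y p)))"

text \<open>The spanning clause says that the \<open>CARD('n)\<close> orthonormal vectors form a basis of the tangent
  space.\<close>
definition orthonormal_frame ::
  "('m::topological_space, 'n::finite) atlas \<Rightarrow> ('m \<Rightarrow> 'm tvec \<Rightarrow> 'm tvec \<Rightarrow> real) \<Rightarrow>
   'm set \<Rightarrow> ('n \<Rightarrow> 'm vfield) \<Rightarrow> bool" where
  "orthonormal_frame \<A> g U e \<longleftrightarrow>
     open U \<and> (\<forall>i. vfield_on \<A> U (e i)) \<and>
     (\<forall>p\<in>U. \<forall>i j. g p (e i p) (e j p) = (if i = j then 1 else 0)) \<and>
     (\<forall>p\<in>U. \<forall>v. tangent \<A> p v \<longrightarrow> (\<exists>c. v = (\<lambda>f. \<Sum>i\<in>UNIV. c i * e i p f)))"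

text \<open>\<open>nab p v Y\<close> is the covariant derivative at \<open>p\<close> of a vector field \<open>Y\<close> defined near \<open>p\<close>, in the
  direction of the tangent vector \<open>v\<close>.\<close>

type_synonym 'm conn = "'m \<Rightarrow> 'm tvec \<Rightarrow> 'm vfield \<Rightarrow> 'm tvec"

definition connection ::
  "('m::topological_space, 'n::finite) atlas \<Rightarrow> 'm conn \<Rightarrow> bool" where
  "connection \<A> nab \<longleftrightarrow>
     (\<forall>U p v Y. vfield_on \<A> U Y \<and> p \<in> U \<and> tangent \<A> p v \<longrightarrow> tangent \<A> p (nab p v Y)) \<and>
     (\<forall>U p v w a b Y. vfield_on \<A> U Y \<and> p \<in> U \<and> tangent \<A> p v \<and> tangent \<A> p w \<longrightarrow>
        nab p (vadd (vscale a v) (vscale b w)) Y = vadd (vscale a (nab p v Y)) (vscale b (nab p w Y))) \<and>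
     (\<forall>U p v Y Z. vfield_on \<A> U Y \<and> vfield_on \<A> U Z \<and> p \<in> U \<and> tangent \<A> p v \<longrightarrow>
        nab p v (\<lambda>q. vadd (Y q) (Z q)) = vadd (nab p v Y) (nab p v Z)) \<and>
     (\<forall>U p v f Y. vfield_on \<A> U Y \<and> smooth_fun \<A> U f \<and> p \<in> U \<and> tangent \<A> p v \<longrightarrow>
        nab p v (\<lambda>q. vscale (f q) (Y q)) = vadd (vscale (v f) (Y p)) (vscale (f p) (nab p v Y))) \<and>
     (\<forall>U p v Y Z. vfield_on \<A> U Y \<and> vfield_on \<A> U Z \<and> (\<forall>q\<in>U. Y q = Z q) \<and> p \<in> U \<and> tangent \<A> p v \<longrightarrow>
        nab p v Y = nab p v Z) \<and>
     (\<forall>U X Y. vfield_on \<A> U X \<and> vfield_on \<A> U Y \<longrightarrow> vfield_on \<A> U (\<lambda>p. nab p (X p) Y))"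

definition metric_connection ::
  "('m::topological_space, 'n::finite) atlas \<Rightarrow> ('m \<Rightarrow> 'm tvec \<Rightarrow> 'm tvec \<Rightarrow> real) \<Rightarrow>
   'm conn \<Rightarrow> bool" where
  "metric_connection \<A> g nab \<longleftrightarrow>
     connection \<A> nab \<and>
     (\<forall>U p v Y Z. vfield_on \<A> U Y \<and> vfield_on \<A> U Z \<and> p \<in> U \<and> tangent \<A> p v \<longrightarrow>
        v (\<lambda>q. g q (Y q) (Z q)) = g p (nab p v Y) (Z p) + g p (Y p) (nab p v Z))"

definition cov :: "'m conn \<Rightarrow> 'm vfield \<Rightarrow> 'm vfield \<Rightarrow> 'm vfield" where
  "cov nab X Y = (\<lambda>p. nab p (X p) Y)"

definition torsion ::
  "('m::topological_space, 'n::finite) atlas \<Rightarrow> 'm conn \<Rightarrow> 'm vfield \<Rightarrow> 'm vfield \<Rightarrow> 'm vfield" where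
  "torsion \<A> nab X Y =
     (\<lambda>p f. cov nab X Y p f - cov nab Y X p f - lie_bracket \<A> X Y p f)"

definition levi_civita ::
  "('m::topological_space, 'n::finite) atlas \<Rightarrow> ('m \<Rightarrow> 'm tvec \<Rightarrow> 'm tvec \<Rightarrow> real) \<Rightarrow>
   'm conn \<Rightarrow> bool" where
  "levi_civita \<A> g nab \<longleftrightarrow>
     metric_connection \<A> g nab \<and>
     (\<forall>U X Y. vfield_on \<A> U X \<and> vfield_on \<A> U Y \<longrightarrow> (\<forall>p\<in>U. torsion \<A> nab X Y p = (\<lambda>f. 0)))"

text \<open>A differential form is a function of a list of vector fields, which may be defined on any open
  set; a \<open>k\<close>-form is of interest on lists of length \<open>k\<close> only.\<close>

type_synonym 'm form = "'m vfield list \<Rightarrow> 'm \<Rightarrow> real"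

definition differential_form ::
  "('m::topological_space, 'n::finite) atlas \<Rightarrow> nat \<Rightarrow> 'm form \<Rightarrow> bool" where
  "differential_form \<A> k \<omega> \<longleftrightarrow>
     (\<forall>U Xs. length Xs = k \<and> (\<forall>X\<in>set Xs. vfield_on \<A> U X) \<and> open U \<longrightarrow>
        smooth_fun \<A> U (\<omega> Xs) \<and>
        (\<forall>i<k. \<forall>Y f. vfield_on \<A> U Y \<and> smooth_fun \<A> U f \<longrightarrow>
           (\<forall>p\<in>U. \<omega> (Xs[i := \<lambda>q. vadd (vscale (f q) ((Xs ! i) q)) (Y q)]) p
                  = f p * \<omega> Xs p + \<omega> (Xs[i := Y]) p)) \<and>
        (\<forall>i<k. \<forall>j<k. i \<noteq> j \<longrightarrow>
           (\<forall>p\<in>U. \<omega> (Xs[i := Xs ! j, j := Xs ! i]) p = - \<omega> Xs p)))"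

definition torsion_form ::
  "('m::topological_space, 'n::finite) atlas \<Rightarrow> ('m \<Rightarrow> 'm tvec \<Rightarrow> 'm tvec \<Rightarrow> real) \<Rightarrow>
   'm conn \<Rightarrow> 'm form" where
  "torsion_form \<A> g nab Xs p = g p (torsion \<A> nab (Xs ! 0) (Xs ! 1) p) ((Xs ! 2) p)"

definition interior_prod :: "'m vfield \<Rightarrow> 'm form \<Rightarrow> 'm form" where
  "interior_prod X \<omega> Xs p = \<omega> (X # Xs) p"

definition cov_form :: "'m conn \<Rightarrow> 'm vfield \<Rightarrow> 'm form \<Rightarrow> 'm form" where
  "cov_form nab X \<omega> Xs p =
     X p (\<lambda>q. \<omega> Xs q) - (\<Sum>j<length Xs. \<omega> (Xs[j := cov nab X (Xs ! j)]) p)"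

text \<open>Exterior product of the covector dual to \<open>X\<close> with \<open>\<omega>\<close>.\<close>
definition wedge_vec ::
  "('m \<Rightarrow> 'm tvec \<Rightarrow> 'm tvec \<Rightarrow> real) \<Rightarrow> 'm vfield \<Rightarrow> 'm form \<Rightarrow> 'm form" where
  "wedge_vec g X \<omega> Xs p =
     (\<Sum>j<length Xs. (-1) ^ j * g p (X p) ((Xs ! j) p) * \<omega> (take j Xs @ drop (Suc j) Xs) p)"

text \<open>In the next two definitions \<open>nabg\<close> is the Levi-Civita connection and \<open>e\<close> a local orthonormal
  frame.\<close>

definition ext_d ::
  "('m \<Rightarrow> 'm tvec \<Rightarrow> 'm tvec \<Rightarrow> real) \<Rightarrow> 'm conn \<Rightarrow> ('n::finite \<Rightarrow> 'm vfield) \<Rightarrow> 'm form \<Rightarrow> 'm form" where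
  "ext_d g nabg e \<omega> Xs p = (\<Sum>i\<in>UNIV. wedge_vec g (e i) (cov_form nabg (e i) \<omega>) Xs p)"

definition codiff :: "'m conn \<Rightarrow> ('n::finite \<Rightarrow> 'm vfield) \<Rightarrow> 'm form \<Rightarrow> 'm form" where
  "codiff nabg e \<omega> Xs p = - (\<Sum>i\<in>UNIV. interior_prod (e i) (cov_form nabg (e i) \<omega>) Xs p)"

definition sigma_form ::
  "('m::topological_space, 'n::finite) atlas \<Rightarrow> ('m \<Rightarrow> 'm tvec \<Rightarrow> 'm tvec \<Rightarrow> real) \<Rightarrow>
   'm conn \<Rightarrow> 'm form" where
  "sigma_form \<A> g nab Xs p =
     (let T = (\<lambda>i j. torsion \<A> nab (Xs ! i) (Xs ! j) p)
      in g p (T 0 1) (T 2 3) + g p (T 1 2) (T 0 3) + g p (T 2 0) (T 1 3))"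

definition curvature ::
  "('m::topological_space, 'n::finite) atlas \<Rightarrow> 'm conn \<Rightarrow>
   'm vfield \<Rightarrow> 'm vfield \<Rightarrow> 'm vfield \<Rightarrow> 'm vfield" where
  "curvature \<A> nab X Y Z =
     (\<lambda>p f. cov nab X (cov nab Y Z) p f - cov nab Y (cov nab X Z) p f
            - cov nab (lie_bracket \<A> X Y) Z p f)"

definition scalar_curvature ::
  "('m::topological_space, 'n::finite) atlas \<Rightarrow> ('m \<Rightarrow> 'm tvec \<Rightarrow> 'm tvec \<Rightarrow> real) \<Rightarrow>
   'm conn \<Rightarrow> ('n \<Rightarrow> 'm vfield) \<Rightarrow> 'm \<Rightarrow> real" where
  "scalar_curvature \<A> g nab e p =
     (\<Sum>i\<in>UNIV. \<Sum>j\<in>UNIV. g p (curvature \<A> nab (e i) (e j) (e j) p) (e i p))"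

section \<open>Spin structures and spinor fields\<close>

text \<open>The complex spinor module of the Clifford algebra with \<open>x \<cdot> x = - \<bar>x\<bar>\<^sup>2\<close>, given by the
  matrices of the standard basis vectors. For odd \<open>CARD('n)\<close> there are two such modules; either is
  allowed.\<close>

definition spinor_module :: "('n::finite \<Rightarrow> complex ^ 's::finite ^ 's) \<Rightarrow> bool" where
  "spinor_module \<gamma> \<longleftrightarrow>
     CARD('s) = 2 ^ (CARD('n) div 2) \<and>
     (\<forall>i j. \<gamma> i ** \<gamma> j + \<gamma> j ** \<gamma> i = (if i = j then mat (-2) else 0))"

definition clifford :: "('n::finite \<Rightarrow> complex ^ 's::finite ^ 's) \<Rightarrow> real ^ 'n \<Rightarrow> complex ^ 's ^ 's" where
  "clifford \<gamma> x = (\<Sum>i\<in>UNIV. (x $ i) *\<^sub>R \<gamma> i)"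

text \<open>Products of an even number of unit vectors. The spinor module is faithful on the even part of
  the Clifford algebra, so the spin group is identified with its image.\<close>
definition spin_group :: "('n::finite \<Rightarrow> complex ^ 's::finite ^ 's) \<Rightarrow> (complex ^ 's ^ 's) set" where
  "spin_group \<gamma> =
     {foldr (\<lambda>x M. clifford \<gamma> x ** M) xs (mat 1) | xs. even (length xs) \<and> (\<forall>x\<in>set xs. norm x = 1)}"

text \<open>A spin structure in terms of a trivialising cover: local sections of the orthonormal frame
  bundle, and lifts to the spin group of the transition functions between them.\<close>

record ('m, 'n, 's, 'a) spin_data =
  spin_index :: "'a set"
  spin_dom :: "'a \<Rightarrow> 'm set"
  spin_frame :: "'a \<Rightarrow> 'n \<Rightarrow> 'm \<Rightarrow> ('m \<Rightarrow> real) \<Rightarrow> real"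
  spin_trans :: "'a \<Rightarrow> 'a \<Rightarrow> 'm \<Rightarrow> complex ^ 's ^ 's"

text \<open>\<open>u\<close> covers the orthogonal matrix \<open>A\<close>, that is, \<open>u x u\<^sup>-\<^sup>1 = A x\<close> for all vectors \<open>x\<close>. As \<open>u\<close>
  lies in the spin group, the frames of a spin structure are consistently oriented.\<close>
definition spin_covers ::
  "('n::finite \<Rightarrow> complex ^ 's::finite ^ 's) \<Rightarrow> complex ^ 's ^ 's \<Rightarrow> real ^ 'n ^ 'n \<Rightarrow> bool" where
  "spin_covers \<gamma> u A \<longleftrightarrow>
     u \<in> spin_group \<gamma> \<and> (\<forall>x. u ** clifford \<gamma> x = clifford \<gamma> (A *v x) ** u)"

definition spin_structure ::
  "('m::topological_space, 'n::finite) atlas \<Rightarrow> ('m \<Rightarrow> 'm tvec \<Rightarrow> 'm tvec \<Rightarrow> real) \<Rightarrow>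
   ('n \<Rightarrow> complex ^ 's::finite ^ 's) \<Rightarrow> ('m, 'n, 's, 'a) spin_data \<Rightarrow> bool" where
  "spin_structure \<A> g \<gamma> S \<longleftrightarrow>
     (\<Union>a\<in>spin_index S. spin_dom S a) = UNIV \<and>
     (\<forall>a\<in>spin_index S. orthonormal_frame \<A> g (spin_dom S a) (spin_frame S a)) \<and>
     (\<forall>a\<in>spin_index S. \<forall>b\<in>spin_index S.
        smooth_fun \<A> (spin_dom S a \<inter> spin_dom S b) (spin_trans S a b) \<and>
        (\<forall>p\<in>spin_dom S a \<inter> spin_dom S b.
           spin_covers \<gamma> (spin_trans S a b p)
             (\<chi> i j. g p (spin_frame S a i p) (spin_frame S b j p)))) \<and>
     (\<forall>a\<in>spin_index S. \<forall>b\<in>spin_index S. \<forall>c\<in>spin_index S.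
        \<forall>p\<in>spin_dom S a \<inter> spin_dom S b \<inter> spin_dom S c.
          spin_trans S a b p ** spin_trans S b c p = spin_trans S a c p)"

text \<open>A section of the spinor bundle is represented by its components in the trivialisations.\<close>

type_synonym ('m, 's, 'a) spinor = "'a \<Rightarrow> 'm \<Rightarrow> complex ^ 's"

definition spinor_field ::
  "('m::topological_space, 'n::finite) atlas \<Rightarrow> ('m, 'n, 's::finite, 'a) spin_data \<Rightarrow>
   ('m, 's, 'a) spinor \<Rightarrow> bool" where
  "spinor_field \<A> S \<Psi> \<longleftrightarrow>
     (\<forall>a\<in>spin_index S. smooth_fun \<A> (spin_dom S a) (\<Psi> a)) \<and>
     (\<forall>a\<in>spin_index S. \<forall>b\<in>spin_index S. \<forall>p\<in>spin_dom S a \<inter> spin_dom S b.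
        \<Psi> a p = spin_trans S a b p *v \<Psi> b p)"

definition spinor_mult ::
  "('m \<Rightarrow> 'm tvec \<Rightarrow> 'm tvec \<Rightarrow> real) \<Rightarrow> ('n::finite \<Rightarrow> complex ^ 's::finite ^ 's) \<Rightarrow>
   ('m, 'n, 's, 'a) spin_data \<Rightarrow> 'm vfield \<Rightarrow> ('m, 's, 'a) spinor \<Rightarrow> ('m, 's, 'a) spinor" where
  "spinor_mult g \<gamma> S X \<Psi> a p = clifford \<gamma> (\<chi> i. g p (X p) (spin_frame S a i p)) *v \<Psi> a p"

text \<open>Clifford multiplication by a \<open>k\<close>-form, from its expansion
  \<open>\<omega> = 1/k! \<Sum> \<omega>(e\<^sub>i, e\<^sub>j, \<dots>) e\<^sub>i \<and> e\<^sub>j \<and> \<dots>\<close> over tuples of distinct indices in a local orthonormal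
  frame \<open>e\<close>.\<close>
definition form_mult ::
  "('m \<Rightarrow> 'm tvec \<Rightarrow> 'm tvec \<Rightarrow> real) \<Rightarrow> ('n::finite \<Rightarrow> complex ^ 's::finite ^ 's) \<Rightarrow>
   ('m, 'n, 's, 'a) spin_data \<Rightarrow> ('n \<Rightarrow> 'm vfield) \<Rightarrow> nat \<Rightarrow> 'm form \<Rightarrow>
   ('m, 's, 'a) spinor \<Rightarrow> ('m, 's, 'a) spinor" where
  "form_mult g \<gamma> S e k \<omega> \<Psi> a p =
     (1 / fact k) *\<^sub>R
       (\<Sum>is | length is = k \<and> distinct is.
          \<omega> (map e is) p *\<^sub>R foldr (\<lambda>i. spinor_mult g \<gamma> S (e i)) is \<Psi> a p)"

definition vec_deriv :: "'m tvec \<Rightarrow> ('m \<Rightarrow> complex ^ 's::finite) \<Rightarrow> complex ^ 's" where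
  "vec_deriv v \<psi> = (\<chi> s. Complex (v (\<lambda>q. Re (\<psi> q $ s))) (v (\<lambda>q. Im (\<psi> q $ s))))"

text \<open>The connection induced on spinors by a metric connection, in the trivialisation given by the
  frame \<open>E\<close>: \<open>\<nabla>\<^sub>X \<psi> = X(\<psi>) + 1/4 \<Sum>\<^sub>i\<^sub>j g(\<nabla>\<^sub>X E\<^sub>i, E\<^sub>j) E\<^sub>i \<cdot> E\<^sub>j \<cdot> \<psi>\<close>.\<close>
definition spinor_cov ::
  "('m \<Rightarrow> 'm tvec \<Rightarrow> 'm tvec \<Rightarrow> real) \<Rightarrow> ('n::finite \<Rightarrow> complex ^ 's::finite ^ 's) \<Rightarrow>
   ('m, 'n, 's, 'a) spin_data \<Rightarrow> 'm conn \<Rightarrow> 'm vfield \<Rightarrow>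
   ('m, 's, 'a) spinor \<Rightarrow> ('m, 's, 'a) spinor" where
  "spinor_cov g \<gamma> S nab X \<Psi> a p =
     vec_deriv (X p) (\<Psi> a) +
     (1/4) *\<^sub>R (\<Sum>i\<in>UNIV. \<Sum>j\<in>UNIV.
        g p (cov nab X (spin_frame S a i) p) (spin_frame S a j p) *\<^sub>R (\<gamma> i *v (\<gamma> j *v \<Psi> a p)))"

text \<open>The component of \<open>D \<Psi>\<close> in a trivialisation is computed with the frame of that
  trivialisation, so that \<open>dirac\<close> is an operator on global spinor fields.\<close>
definition dirac ::
  "('m \<Rightarrow> 'm tvec \<Rightarrow> 'm tvec \<Rightarrow> real) \<Rightarrow> ('n::finite \<Rightarrow> complex ^ 's::finite ^ 's) \<Rightarrow>
   ('m, 'n, 's, 'a) spin_data \<Rightarrow> 'm conn \<Rightarrow> ('m, 's, 'a) spinor \<Rightarrow> ('m, 's, 'a) spinor" where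
  "dirac g \<gamma> S nab \<Psi> a p =
     (\<Sum>i\<in>UNIV. spinor_mult g \<gamma> S (spin_frame S a i) (spinor_cov g \<gamma> S nab (spin_frame S a i) \<Psi>) a p)"

definition spinor_laplacian ::
  "('m \<Rightarrow> 'm tvec \<Rightarrow> 'm tvec \<Rightarrow> real) \<Rightarrow> ('n::finite \<Rightarrow> complex ^ 's::finite ^ 's) \<Rightarrow>
   ('m, 'n, 's, 'a) spin_data \<Rightarrow> 'm conn \<Rightarrow> 'm conn \<Rightarrow> ('n \<Rightarrow> 'm vfield) \<Rightarrow>
   ('m, 's, 'a) spinor \<Rightarrow> ('m, 's, 'a) spinor" where
  "spinor_laplacian g \<gamma> S nabg nab e \<Psi> a p =
     (\<Sum>i\<in>UNIV. - spinor_cov g \<gamma> S nab (e i) (spinor_cov g \<gamma> S nab (e i) \<Psi>) a p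
               + spinor_cov g \<gamma> S nab (cov nabg (e i) (e i)) \<Psi> a p)"

end

theory Submission
  imports Defs
begin

text \<open>Everything is computed in the frame \<open>e\<close>, in one trivialisation of the spinor bundle. The
  Leibniz rule \<open>\<nabla>\<^sub>X (Z \<cdot> \<psi>) = \<nabla>\<^sub>X Z \<cdot> \<psi> + Z \<cdot> \<nabla>\<^sub>X \<psi>\<close> turns \<open>D\<^sup>2 \<psi>\<close> into
  \<open>\<Sum>\<^sub>i\<^sub>j e\<^sub>i \<cdot> e\<^sub>j \<cdot> H\<^sub>i\<^sub>j\<close> with \<open>H\<^sub>i\<^sub>j = \<nabla>\<^sub>i \<nabla>\<^sub>j \<psi> - \<nabla>\<^bsub>\<nabla>\<^sub>i e\<^sub>j\<^esub> \<psi>\<close>. The trace of \<open>H\<close> gives the Laplacian, because the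
  torsion is skew; the antisymmetric part is the spinor curvature minus the derivative along
  \<open>T(e\<^sub>i, e\<^sub>j)\<close>. The spinor curvature is \<open>1/4 \<Sum>\<^sub>k\<^sub>l R\<^sub>i\<^sub>j\<^sub>k\<^sub>l e\<^sub>k \<cdot> e\<^sub>l\<close>, and the remaining sum
  \<open>1/8 \<Sum> R\<^sub>i\<^sub>j\<^sub>k\<^sub>l e\<^sub>i \<cdot> e\<^sub>j \<cdot> e\<^sub>k \<cdot> e\<^sub>l\<close> is reduced by cyclic permutation of three factors and the
  first Bianchi identity with torsion, whose right-hand side consists of \<open>\<nabla>\<^sup>g T\<close> and \<open>\<sigma>\<^sup>T\<close>:
  traces produce the scalar curvature and \<open>\<delta> T\<close>, the totally antisymmetric part \<open>d T\<close> and \<open>\<sigma>\<^sup>T\<close>.\<close>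

section \<open>Smooth functions\<close>

text \<open>Two frames have to be reconciled: \<open>E\<close> trivialises the spinor bundle, while
  the formula is stated in \<open>e\<close>. Spinor derivatives use \<open>\<gamma>\<close> and the
  connection form of \<open>E\<close>; Clifford products use the rotated operators
  \<open>act p\<close>. Both sets of operators satisfy one abstract Clifford relation, so the
  algebra is done once. The frames meet in the spinor curvature: in \<open>E\<close> it is known
  only as the lift of some skew matrix, and its coefficients in \<open>e\<close> are read off from
  its commutators with the vectors \<open>e k\<close>. The grading of the Clifford algebra is
  replaced by sums over all index tuples. Exchanging neighbouring factors leaves an explicit
  contraction with fewer factors, and keeping track of these contractions does the work of splitting
  a product of four vectors into its parts of degree 4, 2 and 0.\<close>

lemma Ck_on_subset: "Ck_on k S f \<Longrightarrow> T \<subseteq> S \<Longrightarrow> Ck_on k T f"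
  by (induction k arbitrary: f) (auto intro: continuous_on_subset)

text \<open>\<open>frechet_derivative\<close> looks at all points near \<open>x\<close>; openness
  makes it depend on values in \<open>S\<close> only. The rules for linear maps, sums and products
  use this to replace a derivative by its computed form.\<close>

lemma Ck_on_cong:
  assumes "open S" "\<And>x. x \<in> S \<Longrightarrow> f x = h x" "Ck_on k S f"
  shows "Ck_on k S h"
  using assms(2,3)
proof (induction k arbitrary: f h)
  case 0
  then show ?case by (auto cong: continuous_on_cong)
next
  case (Suc k)
  have hd: "(h has_derivative frechet_derivative f (at x)) (at x)" if "x \<in> S" for x
  proof -
    have "(f has_derivative frechet_derivative f (at x)) (at x)"
      using Suc.prems(2) that by (auto simp: frechet_derivative_works)
    then show ?thesis
      by (rule has_derivative_transform_within_open[OF _ \<open>open S\<close> that]) (rule Suc.prems(1))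
  qed
  have eq: "frechet_derivative f (at x) v = frechet_derivative h (at x) v" if "x \<in> S" for x v
    using frechet_derivative_at[OF hd[OF that]] by simp
  show ?case
  proof (simp, intro conjI ballI allI)
    show "h differentiable at x" if "x \<in> S" for x
      using hd[OF that] by (auto simp: differentiable_def)
    show "Ck_on k S (\<lambda>x. frechet_derivative h (at x) v)" for v
      using Suc.prems(2) by - (rule Suc.IH[of "\<lambda>x. frechet_derivative f (at x) v"], auto simp: eq)
  qed
qed

lemma Ck_on_Suc_imp: "Ck_on (Suc k) S f \<Longrightarrow> Ck_on k S f"
proof (induction k arbitrary: f)
  case 0
  then show ?case
    by (auto intro!: continuous_at_imp_continuous_on differentiable_imp_continuous_within)
next
  case (Suc k)
  show ?case
    unfolding Ck_on.simps(2)[of k]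
    using Suc.prems Suc.IH unfolding Ck_on.simps(2)[of "Suc k"] by blast
qed

lemma Ck_on_const: "Ck_on k S (\<lambda>x. c)"
  by (induction k arbitrary: c) (auto simp: frechet_derivative_const)

lemma Ck_on_linear:
  assumes "open S" "bounded_linear L" "Ck_on k S f"
  shows "Ck_on k S (\<lambda>x. L (f x))"
  using assms(3)
proof (induction k arbitrary: f)
  case 0
  then show ?case using assms(2) by (auto intro: bounded_linear.continuous_on)
next
  case (Suc k)
  have d: "((\<lambda>x. L (f x)) has_derivative (\<lambda>v. L (frechet_derivative f (at x) v))) (at x)" if "x \<in> S" for x
    using Suc.prems that by (intro bounded_linear.has_derivative[OF assms(2)])
      (auto simp: frechet_derivative_works)
  have "Ck_on k S (\<lambda>x. frechet_derivative (\<lambda>x. L (f x)) (at x) v)" for v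
    by (rule Ck_on_cong[OF assms(1) _ Suc.IH[of "\<lambda>x. frechet_derivative f (at x) v"]])
       (use Suc.prems in \<open>auto simp: fun_cong[OF frechet_derivative_at[OF d]]\<close>)
  then show ?case using d by (auto simp: differentiable_def)
qed

lemma Ck_on_add:
  assumes "open S" "Ck_on k S f" "Ck_on k S h"
  shows "Ck_on k S (\<lambda>x. f x + h x)"
  using assms(2,3)
proof (induction k arbitrary: f h)
  case 0
  then show ?case by (auto intro: continuous_on_add)
next
  case (Suc k)
  have d: "((\<lambda>x. f x + h x) has_derivative
      (\<lambda>v. frechet_derivative f (at x) v + frechet_derivative h (at x) v)) (at x)" if "x \<in> S" for x
    using Suc.prems that by (intro has_derivative_add) (auto simp: frechet_derivative_works)
  have "Ck_on k S (\<lambda>x. frechet_derivative (\<lambda>x. f x + h x) (at x) v)" for v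
    by (rule Ck_on_cong[OF assms(1) _ Suc.IH[of "\<lambda>x. frechet_derivative f (at x) v"
          "\<lambda>x. frechet_derivative h (at x) v"]])
       (use Suc.prems in \<open>auto simp: fun_cong[OF frechet_derivative_at[OF d]]\<close>)
  then show ?case using d by (auto simp: differentiable_def)
qed

text \<open>One rule for products of real functions and for scalar multiples of spinors. The product
  rule pairs a derivative with an undifferentiated factor, so the induction step must lower the
  order of that factor.\<close>

lemma Ck_on_bilinear:
  assumes "open S" "bounded_bilinear B" "Ck_on k S f" "Ck_on k S h"
  shows "Ck_on k S (\<lambda>x. B (f x) (h x))"
  using assms(3,4)
proof (induction k arbitrary: f h)
  case 0
  then show ?case using assms(2) by (auto intro: bounded_bilinear.continuous_on)
next
  case (Suc k)
  have d: "((\<lambda>x. B (f x) (h x)) has_derivative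
      (\<lambda>v. B (f x) (frechet_derivative h (at x) v) + B (frechet_derivative f (at x) v) (h x))) (at x)"
    if "x \<in> S" for x
    using Suc.prems that
    by (intro bounded_bilinear.FDERIV[OF assms(2)]) (auto simp: frechet_derivative_works)
  have "Ck_on k S (\<lambda>x. B (f x) (frechet_derivative h (at x) v) + B (frechet_derivative f (at x) v) (h x))" for v
  proof (intro Ck_on_add[OF assms(1)] Suc.IH)
    show "Ck_on k S f" "Ck_on k S h"
      by (rule Ck_on_Suc_imp, fact)+
  qed (use Suc.prems in auto)
  then have "Ck_on k S (\<lambda>x. frechet_derivative (\<lambda>x. B (f x) (h x)) (at x) v)" for v
    by (rule Ck_on_cong[OF assms(1), rotated]) (simp add: fun_cong[OF frechet_derivative_at[OF d]])
  then show ?case using d by (auto simp: differentiable_def)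
qed

lemma open_chart_image:
  assumes "smooth_atlas \<A>" "(V, \<phi>) \<in> \<A>" "open U"
  shows "open (\<phi> ` (U \<inter> V))"
proof -
  have V: "open (\<phi> ` V)" "homeomorphism V (\<phi> ` V) \<phi> (inv_into V \<phi>)"
    using assms unfolding smooth_atlas_def by blast+
  have "openin (top_of_set (\<phi> ` V)) (\<phi> ` (V \<inter> U))"
    by (rule homeomorphism_imp_open_map[OF V(2)]) (rule openin_open_Int[OF assms(3)])
  then show ?thesis
    using openin_open_eq[OF V(1)] by (simp add: Int_commute)
qed

lemma smooth_fun_open: "smooth_fun \<A> U f \<Longrightarrow> open U"
  by (simp add: smooth_fun_def)

lemma smooth_funI:
  assumes "open U" "\<And>V \<phi> k. (V, \<phi>) \<in> \<A> \<Longrightarrow> Ck_on k (\<phi> ` (U \<inter> V)) (\<lambda>x. f (inv_into V \<phi> x))"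
  shows "smooth_fun \<A> U f"
  using assms unfolding smooth_fun_def Cinf_on_def o_def by fast

lemma smooth_funD:
  assumes "smooth_fun \<A> U f" "(V, \<phi>) \<in> \<A>"
  shows "Ck_on k (\<phi> ` (U \<inter> V)) (\<lambda>x. f (inv_into V \<phi> x))"
  using assms unfolding smooth_fun_def Cinf_on_def o_def by fast

context
  fixes \<A> :: "('m::topological_space, 'n::finite) atlas"
  assumes \<A>: "smooth_atlas \<A>"
begin

lemma smooth_fun_subset:
  assumes "smooth_fun \<A> U f" "open V" "V \<subseteq> U"
  shows "smooth_fun \<A> V f"
proof (rule smooth_funI[OF assms(2)])
  show "Ck_on k (\<phi> ` (V \<inter> D)) (\<lambda>x. f (inv_into D \<phi> x))" if "(D, \<phi>) \<in> \<A>" for D \<phi> k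
    by (rule Ck_on_subset[OF smooth_funD[OF assms(1) that]]) (use assms(3) in blast)
qed

lemma smooth_fun_cong:
  assumes "smooth_fun \<A> U f" "\<And>q. q \<in> U \<Longrightarrow> f q = h q"
  shows "smooth_fun \<A> U h"
proof (rule smooth_funI[OF smooth_fun_open[OF assms(1)]])
  fix V \<phi> k assume V: "(V, \<phi>) \<in> \<A>"
  have "homeomorphism V (\<phi> ` V) \<phi> (inv_into V \<phi>)"
    using \<A> V unfolding smooth_atlas_def by blast
  \<comment> \<open>Injectivity brings points of the chart image back into \<open>U\<close>, where
    the two functions agree.\<close>
  then have "inj_on \<phi> V"
    by (intro inj_on_inverseI[of _ "inv_into V \<phi>"]) (rule homeomorphism_apply1)
  then show "Ck_on k (\<phi> ` (U \<inter> V)) (\<lambda>x. h (inv_into V \<phi> x))"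
    by (intro Ck_on_cong[OF open_chart_image[OF \<A> V smooth_fun_open[OF assms(1)]]
          _ smooth_funD[OF assms(1) V]])
      (auto simp: assms(2))
qed

lemma smooth_fun_const: "open U \<Longrightarrow> smooth_fun \<A> U (\<lambda>q. c)"
  by (intro smooth_funI Ck_on_const)

lemma smooth_fun_linear:
  assumes "bounded_linear L" "smooth_fun \<A> U f"
  shows "smooth_fun \<A> U (\<lambda>q. L (f q))"
proof (rule smooth_funI[OF smooth_fun_open[OF assms(2)]])
  fix V \<phi> k assume V: "(V, \<phi>) \<in> \<A>"
  show "Ck_on k (\<phi> ` (U \<inter> V)) (\<lambda>x. L (f (inv_into V \<phi> x)))"
    by (rule Ck_on_linear[OF open_chart_image[OF \<A> V smooth_fun_open[OF assms(2)]] assms(1)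
          smooth_funD[OF assms(2) V]])
qed

lemma smooth_fun_bilinear:
  assumes "bounded_bilinear B" "smooth_fun \<A> U f" "smooth_fun \<A> U h"
  shows "smooth_fun \<A> U (\<lambda>q. B (f q) (h q))"
proof (rule smooth_funI[OF smooth_fun_open[OF assms(2)]])
  fix V \<phi> k assume V: "(V, \<phi>) \<in> \<A>"
  show "Ck_on k (\<phi> ` (U \<inter> V)) (\<lambda>x. B (f (inv_into V \<phi> x)) (h (inv_into V \<phi> x)))"
    by (rule Ck_on_bilinear[OF open_chart_image[OF \<A> V smooth_fun_open[OF assms(2)]] assms(1)
          smooth_funD[OF assms(2) V] smooth_funD[OF assms(3) V]])
qed

lemma smooth_fun_add:
  assumes "smooth_fun \<A> U f" "smooth_fun \<A> U h"
  shows "smooth_fun \<A> U (\<lambda>q. f q + h q)"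
proof (rule smooth_funI[OF smooth_fun_open[OF assms(1)]])
  fix V \<phi> k assume V: "(V, \<phi>) \<in> \<A>"
  show "Ck_on k (\<phi> ` (U \<inter> V)) (\<lambda>x. f (inv_into V \<phi> x) + h (inv_into V \<phi> x))"
    by (rule Ck_on_add[OF open_chart_image[OF \<A> V smooth_fun_open[OF assms(1)]]
          smooth_funD[OF assms(1) V] smooth_funD[OF assms(2) V]])
qed

lemmas smooth_fun_mult = smooth_fun_bilinear[OF bounded_bilinear_mult]
lemmas smooth_fun_scaleR = smooth_fun_bilinear[OF bounded_bilinear_scaleR]

lemma smooth_fun_sum:
  assumes "open U" "\<And>i. i \<in> I \<Longrightarrow> smooth_fun \<A> U (f i)"
  shows "smooth_fun \<A> U (\<lambda>q. \<Sum>i\<in>I. f i q)"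
  using assms(2)
  by (induction I rule: infinite_finite_induct) (simp_all add: smooth_fun_const smooth_fun_add assms(1))

lemma smooth_fun_diff:
  "smooth_fun \<A> U f \<Longrightarrow> smooth_fun \<A> U h \<Longrightarrow> smooth_fun \<A> U (\<lambda>q. f q - h q)"
  using smooth_fun_add[of U f "\<lambda>q. - h q"]
    smooth_fun_linear[OF bounded_linear_minus[OF bounded_linear_ident], of U h] by simp

end

lemma smooth_fun_imp_at: "smooth_fun \<A> U f \<Longrightarrow> p \<in> U \<Longrightarrow> smooth_at \<A> p f"
  by (auto simp: smooth_at_def)

section \<open>Derivations of functions and of spinors\<close>

text \<open>The real basis vectors of the spinor space pick out real and imaginary parts of
  components, on which \<open>vec_deriv\<close> is the scalar derivation. Through this the rules for
  spinors reduce to those for real functions.\<close>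

lemma vec_deriv_inner_Basis:
  assumes "b \<in> Basis"
  shows "vec_deriv v \<psi> \<bullet> b = v (\<lambda>q. \<psi> q \<bullet> b)"
proof -
  obtain s u where "b = axis s u" "u = 1 \<or> u = \<i>"
    using assms by (auto simp: Basis_vec_def Basis_complex_def)
  then show ?thesis
    by (auto simp: vec_deriv_def inner_axis inner_complex_def)
qed

lemma linear_tangent:
  "tangent \<A> p v \<Longrightarrow> tangent \<A> p w \<Longrightarrow> tangent \<A> p (\<lambda>f. a * v f + b * w f)"
  unfolding tangent_def
  by (intro conjI allI impI; (elim conjE)?) (simp_all add: algebra_simps)

context
  fixes \<A> :: "('m::topological_space, 'n::finite) atlas"
  assumes \<A>: "smooth_atlas \<A>"
begin

lemma tangent_zero: "tangent \<A> p (\<lambda>f. 0)"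
  by (simp add: tangent_def)

lemma tangent_sum_scale:
  "(\<And>i. i \<in> I \<Longrightarrow> tangent \<A> p (w i)) \<Longrightarrow> tangent \<A> p (\<lambda>f. \<Sum>i\<in>I. c i * w i f)"
proof (induction I rule: infinite_finite_induct)
  case (insert i I)
  then show ?case
    using linear_tangent[of \<A> p "w i" "\<lambda>f. \<Sum>i\<in>I. c i * w i f" "c i" 1] by simp
qed (simp_all add: tangent_zero)

context
  fixes U :: "'m set" and p :: 'm and v :: "'m tvec"
  assumes v: "tangent \<A> p v" and p: "p \<in> U"
begin

lemma tangent_cong:
  assumes "smooth_fun \<A> U f" "\<And>q. q \<in> U \<Longrightarrow> f q = h q"
  shows "v f = v h"
proof -
  have "\<forall>\<^sub>F q in nhds p. f q = h q"
    using eventually_nhds_in_open[OF smooth_fun_open[OF assms(1)] p]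
    by eventually_elim (rule assms(2))
  then show ?thesis
    using v smooth_fun_imp_at[OF assms(1) p] unfolding tangent_def by blast
qed

lemma tangent_mult:
  "smooth_fun \<A> U f \<Longrightarrow> smooth_fun \<A> U h \<Longrightarrow> v (\<lambda>q. f q * h q) = v f * h p + f p * v h"
  using v smooth_fun_imp_at[OF _ p] unfolding tangent_def by blast

lemma tangent_lincomb:
  "smooth_fun \<A> U f \<Longrightarrow> smooth_fun \<A> U h \<Longrightarrow> v (\<lambda>q. a * f q + b * h q) = a * v f + b * v h"
  using v smooth_fun_imp_at[OF _ p] unfolding tangent_def by blast

lemma tangent_add:
  "smooth_fun \<A> U f \<Longrightarrow> smooth_fun \<A> U h \<Longrightarrow> v (\<lambda>q. f q + h q) = v f + v h"
  using tangent_lincomb[of f h 1 1] by simp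

lemma tangent_diff:
  "smooth_fun \<A> U f \<Longrightarrow> smooth_fun \<A> U h \<Longrightarrow> v (\<lambda>q. f q - h q) = v f - v h"
  using tangent_lincomb[of f h 1 "-1"] by simp

lemma tangent_scale: "smooth_fun \<A> U f \<Longrightarrow> v (\<lambda>q. a * f q) = a * v f"
  using tangent_lincomb[of f f a 0] by simp

lemma tangent_minus: "smooth_fun \<A> U f \<Longrightarrow> v (\<lambda>q. - f q) = - v f"
  using tangent_scale[of f "-1"] by simp

lemma tangent_const:
  assumes "open U"
  shows "v (\<lambda>q. a) = 0"
proof -
  have "v (\<lambda>q. 1 * 1) = v (\<lambda>q. 1) * 1 + 1 * v (\<lambda>q. 1)"
    by (intro tangent_mult smooth_fun_const \<A> assms)
  then have "v (\<lambda>q. 1) = 0" by simp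
  then show ?thesis
    using tangent_scale[of "\<lambda>q. 1" a] smooth_fun_const[OF \<A> assms, of "1::real"] by simp
qed

lemma tangent_sum:
  assumes "open U" "\<And>i. i \<in> I \<Longrightarrow> smooth_fun \<A> U (f i)"
  shows "v (\<lambda>q. \<Sum>i\<in>I. f i q) = (\<Sum>i\<in>I. v (f i))"
  using assms(2)
proof (induction I rule: infinite_finite_induct)
  case (insert i I)
  then show ?case
    by (simp add: tangent_add smooth_fun_sum[OF \<A> assms(1)])
qed (simp_all add: tangent_const[OF assms(1)])

text \<open>The components of \<open>vec_deriv\<close> in the standard basis determine it along every vector, as
  \<open>v\<close> is linear.\<close>
lemma vec_deriv_inner:
  assumes "smooth_fun \<A> U \<psi>"
  shows "vec_deriv v \<psi> \<bullet> y = v (\<lambda>q. \<psi> q \<bullet> y)"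
proof -
  have sm: "smooth_fun \<A> U (\<lambda>q. \<psi> q \<bullet> b)" for b
    by (rule smooth_fun_linear[OF \<A> bounded_linear_inner_left assms])
  have "v (\<lambda>q. \<psi> q \<bullet> y) = v (\<lambda>q. \<Sum>b\<in>Basis. (y \<bullet> b) * (\<psi> q \<bullet> b))"
    by (simp add: euclidean_inner[of _ y] mult.commute)
  also have "\<dots> = (\<Sum>b\<in>Basis. (y \<bullet> b) * v (\<lambda>q. \<psi> q \<bullet> b))"
    by (subst tangent_sum[OF smooth_fun_open[OF assms]])
      (auto intro!: sum.cong tangent_scale sm smooth_fun_mult[OF \<A>] smooth_fun_const[OF \<A>]
        smooth_fun_open[OF assms])
  also have "\<dots> = vec_deriv v \<psi> \<bullet> y"
    by (subst euclidean_inner) (auto intro!: sum.cong simp: vec_deriv_inner_Basis)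
  finally show ?thesis by simp
qed

lemma vec_deriv_linear:
  fixes L :: "complex ^ 't::finite \<Rightarrow> complex ^ 's::finite"
  assumes "smooth_fun \<A> U \<psi>" "linear L"
  shows "vec_deriv v (\<lambda>q. L (\<psi> q)) = L (vec_deriv v \<psi>)"
proof (rule euclidean_eqI)
  fix b :: "complex ^ 's" assume b: "b \<in> Basis"
  \<comment> \<open>The adjoint moves \<open>L\<close> to the test vector, which then need not be a
    basis vector; hence the general form of \<open>vec_deriv_inner\<close>.\<close>
  have "L x \<bullet> b = x \<bullet> adjoint L b" for x
    using adjoint_works[OF assms(2), of x b] by (simp add: inner_commute)
  then show "vec_deriv v (\<lambda>q. L (\<psi> q)) \<bullet> b = L (vec_deriv v \<psi>) \<bullet> b"
    by (simp add: vec_deriv_inner_Basis[OF b] vec_deriv_inner[OF assms(1)])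
qed

lemma vec_deriv_add:
  fixes \<psi> \<eta> :: "'m \<Rightarrow> complex ^ 's::finite"
  assumes "smooth_fun \<A> U \<psi>" "smooth_fun \<A> U \<eta>"
  shows "vec_deriv v (\<lambda>q. \<psi> q + \<eta> q) = vec_deriv v \<psi> + vec_deriv v \<eta>"
proof (rule euclidean_eqI)
  fix b :: "complex ^ 's" assume b: "b \<in> Basis"
  show "vec_deriv v (\<lambda>q. \<psi> q + \<eta> q) \<bullet> b = (vec_deriv v \<psi> + vec_deriv v \<eta>) \<bullet> b"
    by (simp add: vec_deriv_inner_Basis[OF b] inner_add_left tangent_add
        smooth_fun_linear[OF \<A> bounded_linear_inner_left] assms)
qed

lemma vec_deriv_scaleR:
  fixes \<psi> :: "'m \<Rightarrow> complex ^ 's::finite"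
  assumes "smooth_fun \<A> U f" "smooth_fun \<A> U \<psi>"
  shows "vec_deriv v (\<lambda>q. f q *\<^sub>R \<psi> q) = v f *\<^sub>R \<psi> p + f p *\<^sub>R vec_deriv v \<psi>"
proof (rule euclidean_eqI)
  fix b :: "complex ^ 's" assume b: "b \<in> Basis"
  show "vec_deriv v (\<lambda>q. f q *\<^sub>R \<psi> q) \<bullet> b = (v f *\<^sub>R \<psi> p + f p *\<^sub>R vec_deriv v \<psi>) \<bullet> b"
    by (simp add: vec_deriv_inner_Basis[OF b] inner_add_left tangent_mult
        smooth_fun_linear[OF \<A> bounded_linear_inner_left] assms)
qed

lemma vec_deriv_cong:
  fixes \<psi> \<eta> :: "'m \<Rightarrow> complex ^ 's::finite"
  assumes "smooth_fun \<A> U \<psi>" "\<And>q. q \<in> U \<Longrightarrow> \<psi> q = \<eta> q"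
  shows "vec_deriv v \<psi> = vec_deriv v \<eta>"
proof (rule euclidean_eqI)
  fix b :: "complex ^ 's" assume b: "b \<in> Basis"
  show "vec_deriv v \<psi> \<bullet> b = vec_deriv v \<eta> \<bullet> b"
    unfolding vec_deriv_inner_Basis[OF b]
    by (rule tangent_cong[OF smooth_fun_linear[OF \<A> bounded_linear_inner_left assms(1)]])
      (simp add: assms(2))
qed

lemma vec_deriv_zero: "open U \<Longrightarrow> vec_deriv v (\<lambda>q. 0) = 0"
  by (simp add: vec_deriv_def vec_eq_iff complex_eq_iff tangent_const)

lemma vec_deriv_sum:
  assumes "open U" "\<And>i. i \<in> I \<Longrightarrow> smooth_fun \<A> U (\<psi> i)"
  shows "vec_deriv v (\<lambda>q. \<Sum>i\<in>I. \<psi> i q) = (\<Sum>i\<in>I. vec_deriv v (\<psi> i))"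
  using assms(2)
proof (induction I rule: infinite_finite_induct)
  case (insert i I)
  then show ?case
    by (simp add: vec_deriv_add smooth_fun_sum[OF \<A> assms(1)])
qed (simp_all add: vec_deriv_zero[OF assms(1)])

end

lemma vfield_tangent: "vfield_on \<A> U X \<Longrightarrow> p \<in> U \<Longrightarrow> tangent \<A> p (X p)"
  by (simp add: vfield_on_def)

lemma vfield_smooth: "vfield_on \<A> U X \<Longrightarrow> smooth_fun \<A> U f \<Longrightarrow> smooth_fun \<A> U (\<lambda>q. X q f)"
  by (simp add: vfield_on_def)

lemma vfield_subset: "vfield_on \<A> U X \<Longrightarrow> open V \<Longrightarrow> V \<subseteq> U \<Longrightarrow> vfield_on \<A> V X"
  unfolding vfield_on_def by blast

text \<open>\<open>vfield_on\<close> speaks about real functions, so the spinor is reassembled from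
  its real components.\<close>

lemma smooth_vec_deriv:
  assumes "vfield_on \<A> U X" "smooth_fun \<A> U \<psi>"
  shows "smooth_fun \<A> U (\<lambda>q. vec_deriv (X q) \<psi>)"
proof -
  have "smooth_fun \<A> U (\<lambda>q. \<Sum>b\<in>Basis. X q (\<lambda>r. \<psi> r \<bullet> b) *\<^sub>R b)"
    by (intro smooth_fun_sum[OF \<A>] smooth_fun_scaleR[OF \<A>] smooth_fun_const[OF \<A>]
        vfield_smooth[OF assms(1)] smooth_fun_linear[OF \<A> bounded_linear_inner_left]
        assms(2) smooth_fun_open[OF assms(2)])
  moreover have "(\<Sum>b\<in>Basis. X q (\<lambda>r. \<psi> r \<bullet> b) *\<^sub>R b) = vec_deriv (X q) \<psi>" for q
    by (subst (2) euclidean_representation[symmetric]) (simp add: vec_deriv_inner_Basis)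
  ultimately show ?thesis by simp
qed

text \<open>On each real component this is the definition of the bracket; smoothness of the
  component at \<open>p\<close> excludes the default value 0 there.\<close>

lemma vec_deriv_lie_bracket:
  fixes \<psi> :: "'m \<Rightarrow> complex ^ 's::finite"
  assumes "smooth_fun \<A> U \<psi>" "p \<in> U"
  shows "vec_deriv (X p) (\<lambda>q. vec_deriv (Y q) \<psi>) - vec_deriv (Y p) (\<lambda>q. vec_deriv (X q) \<psi>)
    = vec_deriv (lie_bracket \<A> X Y p) \<psi>"
proof (rule euclidean_eqI)
  fix b :: "complex ^ 's" assume b: "b \<in> Basis"
  have "smooth_at \<A> p (\<lambda>q. \<psi> q \<bullet> b)"
    by (rule smooth_fun_imp_at[OF smooth_fun_linear[OF \<A> bounded_linear_inner_left assms(1)] assms(2)])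
  then show "(vec_deriv (X p) (\<lambda>q. vec_deriv (Y q) \<psi>) - vec_deriv (Y p) (\<lambda>q. vec_deriv (X q) \<psi>)) \<bullet> b
      = vec_deriv (lie_bracket \<A> X Y p) \<psi> \<bullet> b"
    by (simp add: inner_diff_left vec_deriv_inner_Basis[OF b] lie_bracket_def)
qed

end

section \<open>Contractions in the Clifford algebra\<close>

lemma sum3_rotate:
  "(\<Sum>i\<in>A. \<Sum>j\<in>A. \<Sum>k\<in>A. f i j k) = (\<Sum>i\<in>A. \<Sum>j\<in>A. \<Sum>k\<in>A. f j k i)"
proof -
  have "(\<Sum>i\<in>A. \<Sum>j\<in>A. \<Sum>k\<in>A. f j k i) = (\<Sum>j\<in>A. \<Sum>i\<in>A. \<Sum>k\<in>A. f j k i)"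
    by (rule sum.swap)
  also have "\<dots> = (\<Sum>j\<in>A. \<Sum>k\<in>A. \<Sum>i\<in>A. f j k i)"
    by (rule sum.cong[OF refl sum.swap])
  finally show ?thesis by simp
qed

lemma eq_minus_diffI: "a + b = - d \<Longrightarrow> a = - b - d" for a b d :: "'a::ab_group_add"
  by (metis add_diff_cancel_right' diff_conv_add_uminus add.commute)

lemma scaleR_numerals:
  "2 *\<^sub>R a = a + a" "3 *\<^sub>R a = a + a + a" "4 *\<^sub>R a = a + a + a + a"
  "6 *\<^sub>R a = a + a + a + a + a + a" for a :: "'a::real_vector"
  using scaleR_left_distrib[of 2 1 a] scaleR_left_distrib[of 2 2 a] scaleR_left_distrib[of 4 2 a]
  by (simp_all add: scaleR_2)

text \<open>Applied both to the matrices of the trivialising frame and, at a fixed point, to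
  Clifford multiplication by the vectors of \<open>e\<close>.\<close>

locale clifford_action =
  fixes c :: "'n::finite \<Rightarrow> 'v::real_vector \<Rightarrow> 'v"
  assumes linear: "linear (c i)"
    and anticommute: "c i (c j x) + c j (c i x) = (if i = j then - 2 *\<^sub>R x else 0)"
begin

lemma act_add: "c i (x + y) = c i x + c i y"
  and act_diff: "c i (x - y) = c i x - c i y"
  and act_minus: "c i (- x) = - c i x"
  and act_scaleR: "c i (r *\<^sub>R x) = r *\<^sub>R c i x"
  and act_zero: "c i 0 = 0"
  and act_sum: "c i (\<Sum>k\<in>A. f k) = (\<Sum>k\<in>A. c i (f k))"
  using linear by (simp_all add: linear_add linear_diff linear_neg linear_cmul linear_0 linear_sum)

lemmas act_simps = act_add act_diff act_minus act_scaleR act_zero act_sum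

lemma act_swap: "c i (c j x) = - c j (c i x) - (if i = j then 2 *\<^sub>R x else 0)"
  using anticommute[of i j x] by (auto simp: eq_neg_iff_add_eq_0 algebra_simps)

text \<open>The vectors \<open>y i j\<close> are arbitrary: they will be weighted copies of one
  vector, inner sums of longer products, and second derivatives of a spinor.\<close>

lemma sum_anticommute:
  "(\<Sum>i\<in>UNIV. \<Sum>j\<in>UNIV. c i (c j (y i j))) + (\<Sum>i\<in>UNIV. \<Sum>j\<in>UNIV. c i (c j (y j i)))
     = - 2 *\<^sub>R (\<Sum>i\<in>UNIV. y i i)"
proof -
  have "(\<Sum>i\<in>UNIV. \<Sum>j\<in>UNIV. c i (c j (y j i))) = (\<Sum>i\<in>UNIV. \<Sum>j\<in>UNIV. c j (c i (y i j)))"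
    by (rule sum.swap)
  then show ?thesis
    by (simp add: anticommute scaleR_sum_right sum_negf flip: sum.distrib)
qed

text \<open>Repeated indices are included. For an alternating weight, \<open>wsum2\<close> is 2
  times and \<open>wsum4\<close> 24 times the Clifford action of the form; for other weights they
  also contain traces.\<close>

definition wsum2 :: "('n \<Rightarrow> 'n \<Rightarrow> real) \<Rightarrow> 'v \<Rightarrow> 'v" where
  "wsum2 f x = (\<Sum>i\<in>UNIV. \<Sum>j\<in>UNIV. f i j *\<^sub>R c i (c j x))"

definition wsum4 :: "('n \<Rightarrow> 'n \<Rightarrow> 'n \<Rightarrow> 'n \<Rightarrow> real) \<Rightarrow> 'v \<Rightarrow> 'v" where
  "wsum4 f x = (\<Sum>i\<in>UNIV. \<Sum>j\<in>UNIV. \<Sum>k\<in>UNIV. \<Sum>l\<in>UNIV. f i j k l *\<^sub>R c i (c j (c k (c l x))))"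

lemma wsum2_add: "wsum2 (\<lambda>i j. f i j + g i j) x = wsum2 f x + wsum2 g x"
  and wsum2_scale: "wsum2 (\<lambda>i j. r * f i j) x = r *\<^sub>R wsum2 f x"
  and wsum2_minus: "wsum2 (\<lambda>i j. - f i j) x = - wsum2 f x"
  and wsum2_diff: "wsum2 (\<lambda>i j. f i j - g i j) x = wsum2 f x - wsum2 g x"
  by (simp_all add: wsum2_def scaleR_add_left scaleR_diff_left sum.distrib sum_subtractf
      scaleR_sum_right sum_negf)

lemma wsum4_add: "wsum4 (\<lambda>i j k l. f i j k l + g i j k l) x = wsum4 f x + wsum4 g x"
  and wsum4_scale: "wsum4 (\<lambda>i j k l. r * f i j k l) x = r *\<^sub>R wsum4 f x"
  and wsum4_minus: "wsum4 (\<lambda>i j k l. - f i j k l) x = - wsum4 f x"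
  and wsum4_diff: "wsum4 (\<lambda>i j k l. f i j k l - g i j k l) x = wsum4 f x - wsum4 g x"
  by (simp_all add: wsum4_def scaleR_add_left scaleR_diff_left sum.distrib sum_subtractf
      scaleR_sum_right sum_negf)

lemma wsum2_swap: "wsum2 f x = - wsum2 (\<lambda>i j. f j i) x - (2 * (\<Sum>i\<in>UNIV. f i i)) *\<^sub>R x"
proof -
  have "wsum2 f x + wsum2 (\<lambda>i j. f j i) x = - ((2 * (\<Sum>i\<in>UNIV. f i i)) *\<^sub>R x)"
    using sum_anticommute[of "\<lambda>i j. f i j *\<^sub>R x"]
    by (simp add: wsum2_def act_scaleR scaleR_sum_left[symmetric])
  then show ?thesis by (rule eq_minus_diffI)
qed

text \<open>Here and in the next two lemmas, exchanging two neighbouring factors costs a sign and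
  twice the contraction of their slots, which acts through the two remaining factors.\<close>

lemma wsum4_swap12:
  "wsum4 f x = - wsum4 (\<lambda>i j k l. f j i k l) x - 2 *\<^sub>R wsum2 (\<lambda>k l. \<Sum>i\<in>UNIV. f i i k l) x"
proof -
  let ?y = "\<lambda>i j. wsum2 (f i j) x"
  have "(\<Sum>i\<in>UNIV. ?y i i) = wsum2 (\<lambda>k l. \<Sum>i\<in>UNIV. f i i k l) x"
    unfolding wsum2_def scaleR_sum_left by (rule sum3_rotate[symmetric])
  then have "wsum4 f x + wsum4 (\<lambda>i j k l. f j i k l) x
      = - (2 *\<^sub>R wsum2 (\<lambda>k l. \<Sum>i\<in>UNIV. f i i k l) x)"
    using sum_anticommute[of ?y] by (simp add: wsum4_def wsum2_def[of "f _ _"] act_simps)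
  then show ?thesis by (rule eq_minus_diffI)
qed

lemma wsum4_swap23:
  "wsum4 f x = - wsum4 (\<lambda>i j k l. f i k j l) x - 2 *\<^sub>R wsum2 (\<lambda>i l. \<Sum>j\<in>UNIV. f i j j l) x"
proof -
  let ?y = "\<lambda>i j k. \<Sum>l\<in>UNIV. f i j k l *\<^sub>R c l x"
  have y: "(\<Sum>j\<in>UNIV. ?y i j j) = (\<Sum>l\<in>UNIV. (\<Sum>j\<in>UNIV. f i j j l) *\<^sub>R c l x)" for i
    unfolding scaleR_sum_left by (rule sum.swap)
  have "wsum4 f x + wsum4 (\<lambda>i j k l. f i k j l) x =
      (\<Sum>i\<in>UNIV. c i ((\<Sum>j\<in>UNIV. \<Sum>k\<in>UNIV. c j (c k (?y i j k))) + (\<Sum>j\<in>UNIV. \<Sum>k\<in>UNIV. c j (c k (?y i k j)))))"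
    by (simp add: wsum4_def act_simps sum.distrib)
  also have "\<dots> = - (2 *\<^sub>R wsum2 (\<lambda>i l. \<Sum>j\<in>UNIV. f i j j l) x)"
    unfolding sum_anticommute y by (simp add: wsum2_def act_simps scaleR_sum_right sum_negf)
  finally show ?thesis by (rule eq_minus_diffI)
qed

lemma wsum4_swap34:
  "wsum4 f x = - wsum4 (\<lambda>i j k l. f i j l k) x - 2 *\<^sub>R wsum2 (\<lambda>i j. \<Sum>k\<in>UNIV. f i j k k) x"
proof -
  have "wsum4 f x + wsum4 (\<lambda>i j k l. f i j l k) x =
      (\<Sum>i\<in>UNIV. \<Sum>j\<in>UNIV. c i (c j (wsum2 (f i j) x + wsum2 (\<lambda>k l. f i j l k) x)))"
    by (simp add: wsum4_def wsum2_def act_simps sum.distrib)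
  also have "\<dots> = (\<Sum>i\<in>UNIV. \<Sum>j\<in>UNIV. c i (c j (- (2 * (\<Sum>k\<in>UNIV. f i j k k)) *\<^sub>R x)))"
    by (subst wsum2_swap) simp
  also have "\<dots> = - (2 *\<^sub>R wsum2 (\<lambda>i j. \<Sum>k\<in>UNIV. f i j k k) x)"
    by (simp add: wsum2_def act_simps scaleR_sum_right sum_negf)
  finally show ?thesis by (rule eq_minus_diffI)
qed

text \<open>The weights on the left are the cyclic sum that the first Bianchi identity evaluates.\<close>
lemma wsum4_cyclic:
  assumes R: "\<And>i j k l. R i j k l = - R j i k l"
  shows "wsum4 (\<lambda>i j k l. R i j k l + R j k i l + R k i j l) x
     = 3 *\<^sub>R wsum4 R x - 6 *\<^sub>R wsum2 (\<lambda>j l. \<Sum>i\<in>UNIV. R i j i l) x"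
proof -
  let ?A = "wsum2 (\<lambda>j l. \<Sum>i\<in>UNIV. R i j i l) x"
  have R0: "R i i k l = 0" for i k l using R[of i i k l] by simp
  have A: "wsum2 (\<lambda>j l. \<Sum>i\<in>UNIV. R j i i l) x = - ?A"
    by (subst R) (simp add: sum_negf wsum2_minus)
  have n: "wsum4 (\<lambda>i j k l. R j i k l) x = - wsum4 R x"
    by (subst R) (simp add: wsum4_minus)
  \<comment> \<open>A cyclic permutation is two transpositions; the second one is free, being the
    skewness of \<open>R\<close> in its first pair.\<close>
  have 1: "wsum4 (\<lambda>i j k l. R k i j l) x = wsum4 R x - 2 *\<^sub>R ?A"
    by (subst wsum4_swap23) (simp add: n)
  have "wsum4 (\<lambda>i j k l. R j k i l) x = - wsum4 (\<lambda>i j k l. R k j i l) x"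
    by (subst wsum4_swap23) (simp add: R0 wsum2_def)
  also have "\<dots> = wsum4 (\<lambda>i j k l. R k i j l) x - 2 *\<^sub>R ?A"
    by (subst wsum4_swap12) (simp add: A)
  finally show ?thesis
    by (simp add: wsum4_add 1 scaleR_numerals)
qed

text \<open>To be applied with \<open>P = \<nabla>\<^sup>g T\<close>, derivative slot first; then \<open>N\<close> is the action of \<open>- 2 \<delta> T\<close>.\<close>
lemma wsum4_alternating:
  fixes x :: 'v and P :: "'n \<Rightarrow> 'n \<Rightarrow> 'n \<Rightarrow> 'n \<Rightarrow> real"
  assumes P1: "\<And>a i j k. P a i j k = - P a j i k" and P2: "\<And>a i j k. P a i j k = - P a i k j"
  defines "N \<equiv> wsum2 (\<lambda>j k. \<Sum>i\<in>UNIV. P i i j k) x"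
  shows "wsum4 (\<lambda>i j k l. P j i k l) x = - wsum4 P x - 2 *\<^sub>R N"
    and "wsum4 (\<lambda>i j k l. P k i j l) x = wsum4 P x + 4 *\<^sub>R N"
    and "wsum4 (\<lambda>i j k l. P l i j k) x = - wsum4 P x - 6 *\<^sub>R N"
proof -
  have N1: "wsum2 (\<lambda>j k. \<Sum>i\<in>UNIV. P i j i k) x = - N"
    by (subst P1) (simp add: N_def sum_negf wsum2_minus)
  \<comment> \<open>A cyclic permutation of the three alternating slots is even, so this contraction
    has the sign of \<open>N\<close>, unlike the one in \<open>N1\<close>.\<close>
  have P3: "P i j k i = P i i j k" for i j k
    using P2[of i j k i] P1[of i j i k] by simp
  have N2: "wsum2 (\<lambda>j k. \<Sum>i\<in>UNIV. P i j k i) x = N"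
    by (subst P3) (simp add: N_def)
  \<comment> \<open>Each step moves the derivative slot one place further. The sign flips, and the
    contractions \<open>N\<close>, \<open>-N\<close>, \<open>N\<close> met on the way accumulate to
    the coefficients -2, 4, -6.\<close>
  show 1: "wsum4 (\<lambda>i j k l. P j i k l) x = - wsum4 P x - 2 *\<^sub>R N"
    by (subst wsum4_swap12) (simp add: N_def)
  show 2: "wsum4 (\<lambda>i j k l. P k i j l) x = wsum4 P x + 4 *\<^sub>R N"
    by (subst wsum4_swap23) (simp add: N1 1 scaleR_numerals)
  show 3: "wsum4 (\<lambda>i j k l. P l i j k) x = - wsum4 P x - 6 *\<^sub>R N"
    by (subst wsum4_swap34) (simp add: N2 2 scaleR_numerals)
qed

text \<open>\<open>wsum4_cyclic\<close> yields three copies of \<open>wsum4 R\<close> up to a Ricci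
  contraction. Contracting the same Bianchi identity gives the skew part of that contraction, and
  its symmetric part acts only through its trace, so everything is determined. In
  \<open>bianchi\<close> the cyclic sum of derivatives has been completed to \<open>dT\<close>,
  leaving over the single term \<open>P l i j k\<close>.\<close>

lemma wsum4_curvature:
  assumes R: "\<And>i j k l. R i j k l = - R j i k l" and R': "\<And>i j k l. R i j k l = - R i j l k"
    and P1: "\<And>a i j k. P a i j k = - P a j i k" and P2: "\<And>a i j k. P a i j k = - P a i k j"
    and dT: "\<And>i j k l. dT i j k l = P i j k l - P j i k l + P k i j l - P l i j k"
    and \<sigma>: "\<And>i j l. \<sigma> i j l i = 0"
    and bianchi: "\<And>i j k l. R i j k l + R j k i l + R k i j l = dT i j k l + P l i j k - \<sigma> i j k l / 2"
  shows "wsum4 R x = (1/4) *\<^sub>R wsum4 dT x - (1/6) *\<^sub>R wsum4 \<sigma> x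
    - 2 *\<^sub>R wsum2 (\<lambda>j k. \<Sum>i\<in>UNIV. P i i j k) x + (2 * (\<Sum>i\<in>UNIV. \<Sum>j\<in>UNIV. R i j j i)) *\<^sub>R x"
proof -
  define N where "N = wsum2 (\<lambda>j k. \<Sum>i\<in>UNIV. P i i j k) x"
  let ?A = "\<lambda>j l. \<Sum>i\<in>UNIV. R i j i l"
  have "wsum4 dT x = wsum4 P x - wsum4 (\<lambda>i j k l. P j i k l) x
      + wsum4 (\<lambda>i j k l. P k i j l) x - wsum4 (\<lambda>i j k l. P l i j k) x"
    unfolding dT by (simp only: wsum4_add wsum4_diff)
  also have "\<dots> = 4 *\<^sub>R (wsum4 P x + 3 *\<^sub>R N)"
    unfolding wsum4_alternating[of P x, OF P1 P2] N_def[symmetric] by (simp add: scaleR_numerals)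
  \<comment> \<open>Since \<open>dT\<close> acts as four times \<open>P\<close> plus 12
    \<open>N\<close>, the leftover term of the Bianchi identity is itself a multiple of
    \<open>dT\<close> up to \<open>N\<close>.\<close>
  finally have 1: "wsum4 (\<lambda>i j k l. P l i j k) x = - (1/4) *\<^sub>R wsum4 dT x - 3 *\<^sub>R N"
    unfolding wsum4_alternating(3)[of P x, OF P1 P2] N_def[symmetric] by (simp add: scaleR_numerals(2,4))
  have 2: "3 *\<^sub>R wsum4 R x - 6 *\<^sub>R wsum2 ?A x
      = wsum4 dT x + wsum4 (\<lambda>i j k l. P l i j k) x - (1/2) *\<^sub>R wsum4 \<sigma> x"
    unfolding wsum4_cyclic[of R, OF R, symmetric] bianchi
    using wsum4_scale[of "1/2" \<sigma> x] by (simp add: wsum4_add wsum4_diff)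
  \<comment> \<open>First and last slot of the Bianchi identity are contracted: \<open>dT\<close>
    and \<sigma> vanish there, and the divergence of the torsion remains as the obstruction to a
    symmetric Ricci contraction.\<close>
  have "(\<Sum>i\<in>UNIV. R i j l i + R j l i i + R l i j i) = (\<Sum>i\<in>UNIV. P i i j l)" for j l
  proof (rule sum.cong[OF refl])
    fix i
    have "P i j l i = P i i j l" "P j i l i = 0" "P l i j i = 0"
      using P2[of i j l i] P1[of i j i l] P1[of j i l i] P2[of j l i i] P1[of l i j i] P2[of l j i i]
      by simp_all
    then show "R i j l i + R j l i i + R l i j i = P i i j l"
      unfolding bianchi dT \<sigma> by simp
  qed
  moreover have "R i j l i + R j l i i + R l i j i = - (R i j i l - R i l i j)" for i j l
    using R'[of i j l i] R'[of j l i i] R[of l i j i] R'[of i l j i] by simp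
  ultimately have tr': "- (?A j l - ?A l j) = (\<Sum>i\<in>UNIV. P i i j l)" for j l
    by (simp only: sum_subtractf sum_negf)
  have tr: "?A j l - ?A l j = - (\<Sum>i\<in>UNIV. P i i j l)" for j l
    using tr'[of j l] by linarith
  have R2: "R i j j i = - R i j i j" for i j by (rule R')
  \<comment> \<open>Swapping the factors in one of the two copies leaves the skew part of the
    contraction and its trace.\<close>
  have "2 *\<^sub>R wsum2 ?A x = wsum2 ?A x + (- wsum2 (\<lambda>j l. ?A l j) x - (2 * (\<Sum>i\<in>UNIV. ?A i i)) *\<^sub>R x)"
    unfolding scaleR_2 by (rule arg_cong[OF wsum2_swap])
  also have "\<dots> = wsum2 (\<lambda>j l. ?A j l - ?A l j) x - (2 * (\<Sum>i\<in>UNIV. ?A i i)) *\<^sub>R x"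
    by (simp add: wsum2_diff)
  also have "\<dots> = - N + (2 * (\<Sum>i\<in>UNIV. \<Sum>j\<in>UNIV. R i j j i)) *\<^sub>R x"
    unfolding tr N_def R2 by (subst sum.swap) (simp add: wsum2_minus sum_negf)
  finally have 3: "2 *\<^sub>R wsum2 ?A x = - N + (2 * (\<Sum>i\<in>UNIV. \<Sum>j\<in>UNIV. R i j j i)) *\<^sub>R x" .
  \<comment> \<open>With the Ricci contraction added back, the coefficients are a third of: 3/4 for
    \<open>dT\<close>, -1/2 for \<sigma>, -3-3 for \<open>N\<close>, and 6 for the scalar
    curvature.\<close>
  have "wsum4 R x = (1/3) *\<^sub>R ((3 *\<^sub>R wsum4 R x - 6 *\<^sub>R wsum2 ?A x) + 3 *\<^sub>R (2 *\<^sub>R wsum2 ?A x))"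
    by (simp add: algebra_simps)
  also have "\<dots> = (1/4) *\<^sub>R wsum4 dT x - (1/6) *\<^sub>R wsum4 \<sigma> x - 2 *\<^sub>R N
      + (2 * (\<Sum>i\<in>UNIV. \<Sum>j\<in>UNIV. R i j j i)) *\<^sub>R x"
    unfolding 2 1 3 by (simp add: algebra_simps scaleR_2 flip: scaleR_left_distrib scaleR_left_diff_distrib)
  finally show ?thesis by (simp add: N_def)
qed

end

section \<open>The spin Lie algebra and its behaviour under a change of orthonormal frame\<close>

context clifford_action
begin

lemma sum_if_scaleR:
  "(\<Sum>j\<in>UNIV. f j *\<^sub>R (if j = i then g j else 0)) = f i *\<^sub>R (g i :: 'v)" for f :: "'n \<Rightarrow> real"
  by (simp add: if_distrib[of "\<lambda>x. _ *\<^sub>R x"] cong: if_cong)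

text \<open>Lift of a skew matrix to the spin Lie algebra. The 1/4 is forced by
  \<open>spin_rep_act\<close>: two equal contractions arise, each with a factor 2.\<close>

definition spin_rep :: "('n \<Rightarrow> 'n \<Rightarrow> real) \<Rightarrow> 'v \<Rightarrow> 'v" where
  "spin_rep a x = (1/4) *\<^sub>R wsum2 a x"

lemma linear_act_compose: "linear f \<Longrightarrow> linear (\<lambda>x. c i (f x))"
  using linear_compose[OF _ linear, of f] by (simp add: o_def)

lemma linear_wsum2: "linear (wsum2 a)"
  unfolding wsum2_def
  by (intro linear_compose_sum ballI linear_compose_scale_right linear_act_compose linear)

lemma linear_spin_rep: "linear (spin_rep a)"
  unfolding spin_rep_def by (intro linear_compose_scale_right linear_wsum2)

text \<open>\<open>c k\<close> passes \<open>c i\<close> and \<open>c j\<close>, with one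
  contraction each; as \<open>a\<close> is skew, the two contractions add up instead of
  cancelling.\<close>

lemma spin_rep_act:
  assumes "\<And>i j. a i j = - a j i"
  shows "spin_rep a (c k x) = c k (spin_rep a x) + (\<Sum>l\<in>UNIV. a k l *\<^sub>R c l x)"
proof -
  have "c k (c i (c j x)) = c i (c j (c k x)) - (if i = k then 2 *\<^sub>R c j x else 0)
      + (if j = k then 2 *\<^sub>R c i x else 0)" for i j
    by (subst act_swap[of k i], subst act_swap[of k j]) (auto simp: act_simps)
  then have "c i (c j (c k x)) = c k (c i (c j x)) + (if i = k then 2 *\<^sub>R c j x else 0)
      - (if j = k then 2 *\<^sub>R c i x else 0)" for i j
    by simp
  then have "wsum2 a (c k x) = c k (wsum2 a x)
      + (\<Sum>i\<in>UNIV. \<Sum>j\<in>UNIV. a i j *\<^sub>R (if i = k then 2 *\<^sub>R c j x else 0))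
      - (\<Sum>i\<in>UNIV. \<Sum>j\<in>UNIV. a i j *\<^sub>R (if j = k then 2 *\<^sub>R c i x else 0))"
    by (simp add: wsum2_def act_simps scaleR_add_right scaleR_diff_right sum.distrib sum_subtractf)
  also have "(\<Sum>i\<in>UNIV. \<Sum>j\<in>UNIV. a i j *\<^sub>R (if i = k then 2 *\<^sub>R c j x else 0))
      = (\<Sum>j\<in>UNIV. a k j *\<^sub>R (2 *\<^sub>R c j x))"
    by (subst sum.swap) (simp add: sum_if_scaleR)
  also have "(\<Sum>i\<in>UNIV. \<Sum>j\<in>UNIV. a i j *\<^sub>R (if j = k then 2 *\<^sub>R c i x else 0))
      = - (\<Sum>j\<in>UNIV. a k j *\<^sub>R (2 *\<^sub>R c j x))"
    by (simp add: sum_if_scaleR assms[of _ k] sum_negf)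
  finally have "wsum2 a (c k x) = c k (wsum2 a x) + 4 *\<^sub>R (\<Sum>j\<in>UNIV. a k j *\<^sub>R c j x)"
    by (simp add: scaleR_sum_right mult.commute flip: sum.distrib scaleR_left_distrib)
  then show ?thesis
    by (simp add: spin_rep_def scaleR_add_right act_simps)
qed

text \<open>The matrix on the right is \<open>b a - a b\<close>: the order is reversed because, by
  \<open>spin_rep_act\<close>, a matrix acts on the generators through its rows.\<close>

lemma spin_rep_commutator:
  assumes a: "\<And>i j. a i j = - a j i" and b: "\<And>i j. b i j = - b j i"
  shows "spin_rep a (spin_rep b x) - spin_rep b (spin_rep a x)
    = spin_rep (\<lambda>i j. \<Sum>k\<in>UNIV. b i k * a k j - a i k * b k j) x"
proof -
  have L: "spin_rep a (wsum2 b x) = (\<Sum>k\<in>UNIV. \<Sum>l\<in>UNIV. b k l *\<^sub>R spin_rep a (c k (c l x)))"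
    by (simp add: wsum2_def linear_sum[OF linear_spin_rep] linear_cmul[OF linear_spin_rep])
  have "spin_rep a (c k (c l x)) = c k (c l (spin_rep a x)) + (\<Sum>m\<in>UNIV. a l m *\<^sub>R c k (c m x))
      + (\<Sum>m\<in>UNIV. a k m *\<^sub>R c m (c l x))" for k l
    by (simp add: spin_rep_act[of a, OF a] act_simps)
  then have "spin_rep a (wsum2 b x) = wsum2 b (spin_rep a x)
      + (\<Sum>k\<in>UNIV. \<Sum>l\<in>UNIV. \<Sum>m\<in>UNIV. (b k l * a l m) *\<^sub>R c k (c m x))
      + (\<Sum>k\<in>UNIV. \<Sum>l\<in>UNIV. \<Sum>m\<in>UNIV. (b k l * a k m) *\<^sub>R c m (c l x))"
    unfolding L by (simp add: wsum2_def scaleR_add_right sum.distrib scaleR_sum_right)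
  also have "(\<Sum>k\<in>UNIV. \<Sum>l\<in>UNIV. \<Sum>m\<in>UNIV. (b k l * a l m) *\<^sub>R c k (c m x))
      = wsum2 (\<lambda>k m. \<Sum>l\<in>UNIV. b k l * a l m) x"
    unfolding wsum2_def scaleR_sum_left by (intro sum.cong refl sum.swap)
  also have "(\<Sum>k\<in>UNIV. \<Sum>l\<in>UNIV. \<Sum>m\<in>UNIV. (b k l * a k m) *\<^sub>R c m (c l x))
      = (\<Sum>m\<in>UNIV. \<Sum>l\<in>UNIV. \<Sum>k\<in>UNIV. (b k l * a k m) *\<^sub>R c m (c l x))"
    by (subst sum3_rotate) (intro sum.cong refl sum.swap)
  also have "\<dots> = - wsum2 (\<lambda>m l. \<Sum>k\<in>UNIV. a m k * b k l) x"
    unfolding wsum2_def scaleR_sum_left sum_negf[symmetric]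
    by (intro sum.cong refl, subst a) simp
  finally have *: "spin_rep a (wsum2 b x) - wsum2 b (spin_rep a x)
      = wsum2 (\<lambda>k m. \<Sum>l\<in>UNIV. b k l * a l m) x - wsum2 (\<lambda>m l. \<Sum>k\<in>UNIV. a m k * b k l) x"
    by simp
  have "spin_rep a (spin_rep b x) - spin_rep b (spin_rep a x)
      = (1/4) *\<^sub>R (spin_rep a (wsum2 b x) - wsum2 b (spin_rep a x))"
    by (simp add: spin_rep_def[of b] linear_cmul[OF linear_spin_rep] scaleR_diff_right)
  then show ?thesis
    unfolding * by (simp add: spin_rep_def wsum2_diff sum_subtractf)
qed

text \<open>The left side involves only commutators with the generators, so a spin Lie algebra
  element can be recovered from them.\<close>

lemma spin_rep_trace:
  assumes "\<And>i j. a i j = - a j i"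
  shows "(\<Sum>k\<in>UNIV. spin_rep a (c k (c k x)) - c k (spin_rep a (c k x))) = - 4 *\<^sub>R spin_rep a x"
proof -
  have "(\<Sum>k\<in>UNIV. spin_rep a (c k (c k x)) - c k (spin_rep a (c k x)))
      = (\<Sum>k\<in>UNIV. \<Sum>l\<in>UNIV. a k l *\<^sub>R c l (c k x))"
    by (simp add: spin_rep_act[of a, OF assms])
  also have "\<dots> = (\<Sum>l\<in>UNIV. \<Sum>k\<in>UNIV. a k l *\<^sub>R c l (c k x))"
    by (rule sum.swap)
  also have "\<dots> = - wsum2 a x"
    unfolding wsum2_def sum_negf[symmetric] by (intro sum.cong refl, subst assms) simp
  finally show ?thesis by (simp add: spin_rep_def)
qed

text \<open>A contraction does not depend on the orthonormal basis. A linear map is allowed in the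
  middle because \<open>spin_rep a\<close> stands there in \<open>spin_rep_trace\<close>.\<close>

lemma rotated_sum:
  fixes A :: "'n \<Rightarrow> 'n \<Rightarrow> real"
  assumes A: "\<And>m n. (\<Sum>k\<in>UNIV. A k m * A k n) = (if m = n then 1 else 0)"
    and L: "linear L"
  defines "c' \<equiv> \<lambda>k x. \<Sum>m\<in>UNIV. A k m *\<^sub>R c m x"
  shows "(\<Sum>k\<in>UNIV. c' k (L (c' k x))) = (\<Sum>m\<in>UNIV. c m (L (c m x)))"
proof -
  have c': "c' k (L (c' k x)) = (\<Sum>m\<in>UNIV. \<Sum>n\<in>UNIV. (A k m * A k n) *\<^sub>R c m (L (c n x)))" for k
    by (simp add: c'_def linear_sum[OF L] linear_cmul[OF L] act_simps scaleR_sum_right)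
  have "(\<Sum>k\<in>UNIV. c' k (L (c' k x)))
      = (\<Sum>m\<in>UNIV. \<Sum>n\<in>UNIV. (\<Sum>k\<in>UNIV. A k m * A k n) *\<^sub>R c m (L (c n x)))"
    unfolding scaleR_sum_left c' by (rule sum3_rotate[symmetric])
  then show ?thesis
    by (simp add: A if_distrib[of "\<lambda>r. r *\<^sub>R _"] cong: if_cong)
qed

text \<open>An element of the spin Lie algebra is recovered from its commutators with the vectors of any
  orthonormal frame. With this, tensoriality of the curvature is not needed to pass from the
  trivialising frame to the frame of the formula.\<close>
lemma spin_rep_rotated:
  fixes A :: "'n \<Rightarrow> 'n \<Rightarrow> real"
  assumes A: "\<And>m n. (\<Sum>k\<in>UNIV. A k m * A k n) = (if m = n then 1 else 0)"
    and a: "\<And>i j. a i j = - a j i" and R: "\<And>i j. R i j = - R j i"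
  defines "c' \<equiv> \<lambda>k x. \<Sum>m\<in>UNIV. A k m *\<^sub>R c m x"
  assumes comm: "\<And>k x. spin_rep a (c' k x) - c' k (spin_rep a x) = (\<Sum>l\<in>UNIV. R k l *\<^sub>R c' l x)"
  shows "4 *\<^sub>R spin_rep a x = (\<Sum>k\<in>UNIV. \<Sum>l\<in>UNIV. R k l *\<^sub>R c' k (c' l x))"
proof -
  have 1: "(\<Sum>k\<in>UNIV. c' k (L (c' k x))) = (\<Sum>m\<in>UNIV. c m (L (c m x)))" if "linear L" for L
    unfolding c'_def by (rule rotated_sum[OF A that])
  have "- 4 *\<^sub>R spin_rep a x = spin_rep a (\<Sum>k\<in>UNIV. c k (c k x)) - (\<Sum>k\<in>UNIV. c k (spin_rep a (c k x)))"
    unfolding spin_rep_trace[of a, OF a, symmetric] by (simp add: sum_subtractf linear_sum[OF linear_spin_rep])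
  also have "\<dots> = spin_rep a (\<Sum>k\<in>UNIV. c' k (c' k x)) - (\<Sum>k\<in>UNIV. c' k (spin_rep a (c' k x)))"
    using 1[OF linear_ident] 1[OF linear_spin_rep] by simp
  also have "\<dots> = (\<Sum>k\<in>UNIV. \<Sum>l\<in>UNIV. R k l *\<^sub>R c' l (c' k x))"
    by (simp add: linear_sum[OF linear_spin_rep] comm flip: sum_subtractf)
  also have "\<dots> = (\<Sum>l\<in>UNIV. \<Sum>k\<in>UNIV. R k l *\<^sub>R c' l (c' k x))"
    by (rule sum.swap)
  also have "\<dots> = - (\<Sum>k\<in>UNIV. \<Sum>l\<in>UNIV. R k l *\<^sub>R c' k (c' l x))"
    unfolding sum_negf[symmetric] by (intro sum.cong refl, subst R) simp
  finally show ?thesis by simp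
qed

lemma rotated_action:
  fixes A :: "'n \<Rightarrow> 'n \<Rightarrow> real"
  assumes A: "\<And>k l. (\<Sum>m\<in>UNIV. A k m * A l m) = (if k = l then 1 else 0)"
  shows "clifford_action (\<lambda>k x. \<Sum>m\<in>UNIV. A k m *\<^sub>R c m x)"
proof (rule clifford_action.intro)
  show "linear (\<lambda>x. \<Sum>m\<in>UNIV. A k m *\<^sub>R c m x)" for k
    by (intro linear_compose_sum ballI linear_compose_scale_right linear)
  show "(\<Sum>m\<in>UNIV. A i m *\<^sub>R c m (\<Sum>m\<in>UNIV. A j m *\<^sub>R c m x)) +
       (\<Sum>m\<in>UNIV. A j m *\<^sub>R c m (\<Sum>m\<in>UNIV. A i m *\<^sub>R c m x)) =
       (if i = j then - 2 *\<^sub>R x else 0)" for i j x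
  proof -
    have "(\<Sum>m\<in>UNIV. A i m *\<^sub>R c m (\<Sum>m\<in>UNIV. A j m *\<^sub>R c m x))
        = (\<Sum>m\<in>UNIV. \<Sum>n\<in>UNIV. c m (c n ((A i m * A j n) *\<^sub>R x)))"
      "(\<Sum>m\<in>UNIV. A j m *\<^sub>R c m (\<Sum>m\<in>UNIV. A i m *\<^sub>R c m x))
        = (\<Sum>m\<in>UNIV. \<Sum>n\<in>UNIV. c m (c n ((A i n * A j m) *\<^sub>R x)))"
      by (simp_all add: act_simps scaleR_sum_right mult.commute)
    then show ?thesis
      using sum_anticommute[of "\<lambda>m n. (A i m * A j n) *\<^sub>R x"] A[of i j]
      by (simp flip: scaleR_sum_left)
  qed
qed

end

section \<open>Metric connections in an orthonormal frame\<close>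

locale riemannian =
  fixes \<A> :: "('m::topological_space, 'n::finite) atlas"
    and g :: "'m \<Rightarrow> 'm tvec \<Rightarrow> 'm tvec \<Rightarrow> real"
  assumes atlas: "smooth_atlas \<A>"
    and metric: "riemannian_metric \<A> g"
begin

lemma g_sym: "tangent \<A> p v \<Longrightarrow> tangent \<A> p w \<Longrightarrow> g p v w = g p w v"
  using metric unfolding riemannian_metric_def by blast

lemma g_lincomb:
  "tangent \<A> p u \<Longrightarrow> tangent \<A> p v \<Longrightarrow> tangent \<A> p w \<Longrightarrow>
    g p (\<lambda>f. a * u f + b * v f) w = a * g p u w + b * g p v w"
  using metric unfolding riemannian_metric_def vadd_def vscale_def by blast

lemma g_diff:
  "tangent \<A> p u \<Longrightarrow> tangent \<A> p v \<Longrightarrow> tangent \<A> p w \<Longrightarrow>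
    g p (\<lambda>f. u f - v f) w = g p u w - g p v w"
  using g_lincomb[of p u v w 1 "-1"] by simp

lemma tangent_diff_tvec: "tangent \<A> p u \<Longrightarrow> tangent \<A> p v \<Longrightarrow> tangent \<A> p (\<lambda>f. u f - v f)"
  using linear_tangent[of \<A> p u v 1 "-1"] by simp

lemma g_zero: "tangent \<A> p w \<Longrightarrow> g p (\<lambda>f. 0) w = 0"
  using g_lincomb[of p "\<lambda>f. 0" "\<lambda>f. 0" w 0 0] tangent_zero[OF atlas] by simp

lemma g_sum:
  "(\<And>i. i \<in> I \<Longrightarrow> tangent \<A> p (w i)) \<Longrightarrow> tangent \<A> p u \<Longrightarrow>
    g p (\<lambda>f. \<Sum>i\<in>I. c i * w i f) u = (\<Sum>i\<in>I. c i * g p (w i) u)"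
proof (induction I rule: infinite_finite_induct)
  case (insert i I)
  then show ?case
    using g_lincomb[of p "w i" "\<lambda>f. \<Sum>i\<in>I. c i * w i f" u "c i" 1]
      tangent_sum_scale[OF atlas, of I p w c] by simp
qed (simp_all add: g_zero)

lemma g_smooth:
  "vfield_on \<A> U X \<Longrightarrow> vfield_on \<A> U Y \<Longrightarrow> smooth_fun \<A> U (\<lambda>p. g p (X p) (Y p))"
  using metric unfolding riemannian_metric_def by blast

end

locale orthonormal = riemannian \<A> g
  for \<A> :: "('m::topological_space, 'n::finite) atlas" and g +
  fixes U :: "'m set" and e :: "'n \<Rightarrow> 'm vfield"
  assumes frame: "orthonormal_frame \<A> g U e"
begin

lemma frame_open: "open U"
  and frame_vfield: "vfield_on \<A> U (e i)"
  and frame_ortho: "p \<in> U \<Longrightarrow> g p (e i p) (e j p) = (if i = j then 1 else 0)"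
  using frame unfolding orthonormal_frame_def by blast+

lemma frame_tangent: "p \<in> U \<Longrightarrow> tangent \<A> p (e i p)"
  by (rule vfield_tangent[OF atlas frame_vfield])

lemma frame_expand:
  assumes "p \<in> U" "tangent \<A> p v"
  shows "v = (\<lambda>f. \<Sum>i\<in>UNIV. g p v (e i p) * e i p f)"
proof -
  obtain c where c: "v = (\<lambda>f. \<Sum>i\<in>UNIV. c i * e i p f)"
    using frame assms unfolding orthonormal_frame_def by blast
  have "g p v (e j p) = c j" for j
    unfolding c using assms
    by (simp add: g_sum frame_tangent frame_ortho if_distrib cong: if_cong)
  then show ?thesis using c by simp
qed

lemma g_sum_frame:
  assumes "p \<in> U"
  shows "g p (\<lambda>f. \<Sum>i\<in>UNIV. c i * e i p f) (e j p) = c j"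
  using assms by (simp add: g_sum frame_tangent frame_ortho if_distrib cong: if_cong)

lemma parseval:
  assumes "p \<in> U" "tangent \<A> p v" "tangent \<A> p w"
  shows "g p v w = (\<Sum>i\<in>UNIV. g p v (e i p) * g p w (e i p))"
proof -
  have "g p v w = g p (\<lambda>f. \<Sum>i\<in>UNIV. g p v (e i p) * e i p f) w"
    using frame_expand[OF assms(1,2)] by simp
  then show ?thesis
    using assms by (simp add: g_sum frame_tangent g_sym)
qed

lemma orthonormal_subset: "open V \<Longrightarrow> V \<subseteq> U \<Longrightarrow> orthonormal_frame \<A> g V e"
  using frame vfield_subset[OF atlas] unfolding orthonormal_frame_def by blast

end

locale metric_conn = orthonormal \<A> g U e
  for \<A> :: "('m::topological_space, 'n::finite) atlas" and g U e +
  fixes nab :: "'m conn"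
  assumes connection: "metric_connection \<A> g nab"
begin

lemmas connection_clauses = connection[unfolded metric_connection_def connection_def, THEN conjunct1]

lemma nab_tangent:
  "vfield_on \<A> V Y \<Longrightarrow> p \<in> V \<Longrightarrow> tangent \<A> p v \<Longrightarrow> tangent \<A> p (nab p v Y)"
  by (rule connection_clauses[THEN conjunct1, rule_format]) (intro conjI)

lemma nab_lincomb:
  "vfield_on \<A> V Y \<Longrightarrow> p \<in> V \<Longrightarrow> tangent \<A> p v \<Longrightarrow> tangent \<A> p w \<Longrightarrow>
    nab p (\<lambda>f. a * v f + b * w f) Y = (\<lambda>f. a * nab p v Y f + b * nab p w Y f)"
  by (rule connection_clauses[THEN conjunct2, THEN conjunct1, unfolded vadd_def vscale_def, rule_format])
    (intro conjI)

lemma nab_metric: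
  "vfield_on \<A> V Y \<Longrightarrow> vfield_on \<A> V Z \<Longrightarrow> p \<in> V \<Longrightarrow> tangent \<A> p v \<Longrightarrow>
    v (\<lambda>q. g q (Y q) (Z q)) = g p (nab p v Y) (Z p) + g p (Y p) (nab p v Z)"
  by (rule connection[unfolded metric_connection_def, THEN conjunct2, rule_format]) (intro conjI)

lemma cov_vfield: "vfield_on \<A> V X \<Longrightarrow> vfield_on \<A> V Y \<Longrightarrow> vfield_on \<A> V (cov nab X Y)"
  unfolding cov_def
  by (rule connection_clauses[THEN conjunct2, THEN conjunct2, THEN conjunct2, THEN conjunct2,
        THEN conjunct2, rule_format]) (intro conjI)

lemma nab_sum:
  assumes "vfield_on \<A> V Y" "p \<in> V"
  shows "(\<And>i. i \<in> I \<Longrightarrow> tangent \<A> p (w i)) \<Longrightarrow>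
    nab p (\<lambda>f. \<Sum>i\<in>I. c i * w i f) Y = (\<lambda>f. \<Sum>i\<in>I. c i * nab p (w i) Y f)"
proof (induction I rule: infinite_finite_induct)
  case (insert i I)
  then show ?case
    using nab_lincomb[OF assms, of "w i" "\<lambda>f. \<Sum>i\<in>I. c i * w i f" "c i" 1]
      tangent_sum_scale[OF atlas, of I p w c] by simp
qed (use nab_lincomb[OF assms tangent_zero[OF atlas] tangent_zero[OF atlas], of 0 0] in simp_all)

lemma nab_expand:
  assumes "p \<in> U" "vfield_on \<A> U Y" "tangent \<A> p v" "tangent \<A> p z"
  shows "g p (nab p v Y) z = (\<Sum>i\<in>UNIV. g p v (e i p) * g p (nab p (e i p) Y) z)"
  using assms by (subst frame_expand[OF assms(1,3)])
    (simp add: nab_sum[OF assms(2,1)] frame_tangent g_sum nab_tangent[OF assms(2,1)])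

definition coeff :: "'n \<Rightarrow> 'n \<Rightarrow> 'n \<Rightarrow> 'm \<Rightarrow> real" where
  "coeff i j k p = g p (nab p (e i p) (e j)) (e k p)"

lemma nab_frame_antisym:
  assumes "p \<in> U" "tangent \<A> p v"
  shows "g p (nab p v (e i)) (e j p) = - g p (nab p v (e j)) (e i p)"
proof -
  have "v (\<lambda>q. g q (e i q) (e j q)) = v (\<lambda>q. if i = j then 1 else 0)"
    by (rule tangent_cong[OF atlas assms(2,1) g_smooth[OF frame_vfield frame_vfield]])
      (rule frame_ortho)
  also have "\<dots> = 0"
    by (rule tangent_const[OF atlas assms(2,1) frame_open])
  finally show ?thesis
    using nab_metric[OF frame_vfield frame_vfield assms, of i j]
      g_sym[OF frame_tangent[OF assms(1)] nab_tangent[OF frame_vfield assms]]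
    by (metis add.commute eq_neg_iff_add_eq_0)
qed

lemma coeff_antisym: "p \<in> U \<Longrightarrow> coeff i j k p = - coeff i k j p"
  unfolding coeff_def by (intro nab_frame_antisym frame_tangent)

lemma coeff_smooth: "smooth_fun \<A> U (coeff i j k)"
  unfolding coeff_def
  using g_smooth[OF cov_vfield[OF frame_vfield frame_vfield] frame_vfield] by (simp add: cov_def)

text \<open>Metric compatibility is applied to the inner derivative and \<open>e l\<close>: the
  function being differentiated is then a connection coefficient, and the correction is a product of
  coefficients by \<open>parseval\<close>.\<close>

lemma nab_nab_coeff:
  assumes "p \<in> U"
  shows "g p (nab p (e i p) (cov nab (e j) (e k))) (e l p)
    = e i p (coeff j k l) - (\<Sum>m\<in>UNIV. coeff j k m p * coeff i l m p)"
proof -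
  have "e i p (coeff j k l) = g p (nab p (e i p) (cov nab (e j) (e k))) (e l p)
      + g p (cov nab (e j) (e k) p) (nab p (e i p) (e l))"
    using nab_metric[OF cov_vfield[OF frame_vfield[of j] frame_vfield[of k]] frame_vfield[of l] assms
        frame_tangent[OF assms, of i]]
    by (simp add: coeff_def[abs_def] cov_def)
  also have "g p (cov nab (e j) (e k) p) (nab p (e i p) (e l)) =
      (\<Sum>m\<in>UNIV. coeff j k m p * coeff i l m p)"
    unfolding coeff_def cov_def
    by (intro parseval nab_tangent[OF frame_vfield] frame_tangent assms)
  finally show ?thesis by simp
qed

end

section \<open>Lie brackets, torsion and the derivative of the torsion in frame components\<close>

locale torsion_geometry = metric_conn \<A> g U e nab + LC: metric_conn \<A> g U e nabg
  for \<A> :: "('m::topological_space, 'n::finite) atlas" and g U e nab nabg +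
  assumes levi_civita: "levi_civita \<A> g nabg"
    and torsion_3form: "differential_form \<A> 3 (torsion_form \<A> g nab)"
begin

text \<open>The Levi-Civita connection provides the tangency and smoothness of Lie brackets.\<close>
lemma lie_bracket_eq:
  assumes "vfield_on \<A> U X" "vfield_on \<A> U Y" "p \<in> U"
  shows "lie_bracket \<A> X Y p = (\<lambda>f. nabg p (X p) Y f - nabg p (Y p) X f)"
proof
  fix f
  have "torsion \<A> nabg X Y p f = 0"
    using levi_civita assms unfolding levi_civita_def by simp
  then show "lie_bracket \<A> X Y p f = nabg p (X p) Y f - nabg p (Y p) X f"
    by (simp add: torsion_def cov_def)
qed

lemma lie_bracket_tangent:
  assumes "vfield_on \<A> U X" "vfield_on \<A> U Y" "p \<in> U"
  shows "tangent \<A> p (lie_bracket \<A> X Y p)"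
  unfolding lie_bracket_eq[OF assms]
  using assms by (intro tangent_diff_tvec LC.nab_tangent vfield_tangent[OF atlas])

definition struct :: "'n \<Rightarrow> 'n \<Rightarrow> 'n \<Rightarrow> 'm \<Rightarrow> real" where
  "struct i j k p = g p (lie_bracket \<A> (e i) (e j) p) (e k p)"

lemma struct_eq: "p \<in> U \<Longrightarrow> struct i j k p = LC.coeff i j k p - LC.coeff j i k p"
  unfolding struct_def LC.coeff_def lie_bracket_eq[OF frame_vfield frame_vfield]
  by (intro g_diff LC.nab_tangent[OF frame_vfield] frame_tangent)

lemma lie_bracket_frame:
  assumes "p \<in> U"
  shows "lie_bracket \<A> (e i) (e j) p = (\<lambda>f. \<Sum>k\<in>UNIV. struct i j k p * e k p f)"
  unfolding struct_def
  by (rule frame_expand[OF assms lie_bracket_tangent[OF frame_vfield frame_vfield assms]])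

lemma struct_smooth: "smooth_fun \<A> U (struct i j k)"
  by (rule smooth_fun_cong[OF atlas smooth_fun_diff[OF atlas LC.coeff_smooth LC.coeff_smooth]])
    (simp add: struct_eq)

definition tor :: "'n \<Rightarrow> 'n \<Rightarrow> 'n \<Rightarrow> 'm \<Rightarrow> real" where
  "tor i j k = torsion_form \<A> g nab [e i, e j, e k]"

lemma torsion_eq:
  "torsion \<A> nab X Y p = (\<lambda>f. (nab p (X p) Y f - nab p (Y p) X f) - lie_bracket \<A> X Y p f)"
  by (simp add: torsion_def cov_def)

lemma torsion_tangent:
  assumes "vfield_on \<A> U X" "vfield_on \<A> U Y" "p \<in> U"
  shows "tangent \<A> p (torsion \<A> nab X Y p)"
  unfolding torsion_eq
  using assms by (intro tangent_diff_tvec nab_tangent lie_bracket_tangent vfield_tangent[OF atlas])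

lemma tor_eq: "p \<in> U \<Longrightarrow> tor i j k p = coeff i j k p - coeff j i k p - struct i j k p"
  unfolding tor_def torsion_form_def coeff_def struct_def
  by (simp add: torsion_eq g_diff tangent_diff_tvec nab_tangent[OF frame_vfield] frame_tangent
      lie_bracket_tangent[OF frame_vfield frame_vfield])

lemma torsion_form_alternating:
  assumes "vfield_on \<A> U X" "vfield_on \<A> U Y" "vfield_on \<A> U Z" "p \<in> U"
  shows "torsion_form \<A> g nab [Y, X, Z] p = - torsion_form \<A> g nab [X, Y, Z] p"
    and "torsion_form \<A> g nab [X, Z, Y] p = - torsion_form \<A> g nab [X, Y, Z] p"
    and "torsion_form \<A> g nab [Z, Y, X] p = - torsion_form \<A> g nab [X, Y, Z] p"
proof -
  have "length [X, Y, Z] = 3 \<and> (\<forall>X\<in>set [X, Y, Z]. vfield_on \<A> U X) \<and> open U"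
    using assms frame_open by simp
  then have *: "\<forall>i<3. \<forall>j<3. i \<noteq> j \<longrightarrow> (\<forall>p\<in>U. torsion_form \<A> g nab
      ([X, Y, Z][i := [X, Y, Z] ! j, j := [X, Y, Z] ! i]) p = - torsion_form \<A> g nab [X, Y, Z] p)"
    using torsion_3form unfolding differential_form_def by meson
  show "torsion_form \<A> g nab [Y, X, Z] p = - torsion_form \<A> g nab [X, Y, Z] p"
    using *[rule_format, of 0 1 p] assms(4) by simp
  show "torsion_form \<A> g nab [X, Z, Y] p = - torsion_form \<A> g nab [X, Y, Z] p"
    using *[rule_format, of 1 2 p] assms(4) by (simp add: numeral_2_eq_2)
  show "torsion_form \<A> g nab [Z, Y, X] p = - torsion_form \<A> g nab [X, Y, Z] p"
    using *[rule_format, of 0 2 p] assms(4) by (simp add: numeral_2_eq_2)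
qed

lemma tor_antisym:
  assumes "p \<in> U"
  shows "tor j i k p = - tor i j k p" and "tor i k j p = - tor i j k p"
  unfolding tor_def by (intro torsion_form_alternating frame_vfield assms)+

lemma tor_smooth: "smooth_fun \<A> U (tor i j k)"
  by (rule smooth_fun_cong[OF atlas smooth_fun_diff[OF atlas
          smooth_fun_diff[OF atlas coeff_smooth coeff_smooth] struct_smooth]])
    (simp add: tor_eq)

text \<open>The definition makes only the last slot pointwise linear; alternation carries this over to
  the other two.\<close>
lemma torsion_form_slots:
  assumes "vfield_on \<A> U Z" "p \<in> U"
  shows "torsion_form \<A> g nab [e i, e j, Z] p = (\<Sum>m\<in>UNIV. g p (Z p) (e m p) * tor i j m p)"
    and "torsion_form \<A> g nab [e i, Z, e j] p = (\<Sum>m\<in>UNIV. g p (Z p) (e m p) * tor i m j p)"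
    and "torsion_form \<A> g nab [Z, e i, e j] p = (\<Sum>m\<in>UNIV. g p (Z p) (e m p) * tor m i j p)"
proof -
  show 1: "torsion_form \<A> g nab [e i, e j, Z] p = (\<Sum>m\<in>UNIV. g p (Z p) (e m p) * tor i j m p)" for i j
    using parseval[OF assms(2) torsion_tangent[OF frame_vfield frame_vfield assms(2)]
        vfield_tangent[OF atlas assms]]
    by (simp add: torsion_form_def tor_def mult.commute)
  show "torsion_form \<A> g nab [e i, Z, e j] p = (\<Sum>m\<in>UNIV. g p (Z p) (e m p) * tor i m j p)"
    unfolding torsion_form_alternating(2)[OF frame_vfield frame_vfield assms] 1
    by (simp add: tor_antisym(2)[OF assms(2), of i j] sum_negf)
  have "tor m i j p = - tor j i m p" for m
    using tor_antisym[OF assms(2)] by metis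
  then show "torsion_form \<A> g nab [Z, e i, e j] p = (\<Sum>m\<in>UNIV. g p (Z p) (e m p) * tor m i j p)"
    unfolding torsion_form_alternating(3)[OF frame_vfield frame_vfield assms] 1
    by (simp add: sum_negf)
qed

lemma sigma_form_frame:
  assumes "p \<in> U"
  shows "sigma_form \<A> g nab [e i, e j, e k, e l] p =
    (\<Sum>m\<in>UNIV. tor i j m p * tor k l m p + tor j k m p * tor i l m p + tor k i m p * tor j l m p)"
proof -
  have "g p (torsion \<A> nab (e i) (e j) p) (torsion \<A> nab (e k) (e l) p)
      = (\<Sum>m\<in>UNIV. tor i j m p * tor k l m p)" for i j k l
    using parseval[OF assms torsion_tangent[OF frame_vfield frame_vfield assms]
        torsion_tangent[OF frame_vfield frame_vfield assms]]
    by (simp add: tor_def torsion_form_def)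
  then show ?thesis
    by (simp add: sigma_form_def Let_def sum.distrib numeral_2_eq_2 numeral_3_eq_3)
qed

text \<open>The Levi-Civita derivative of the torsion, direction first, because \<open>ext_d\<close>
  and \<open>codiff\<close> are built from it.\<close>

definition dtor :: "'n \<Rightarrow> 'n \<Rightarrow> 'n \<Rightarrow> 'n \<Rightarrow> 'm \<Rightarrow> real" where
  "dtor i j k l = cov_form nabg (e i) (torsion_form \<A> g nab) [e j, e k, e l]"

lemma dtor_eq:
  assumes "p \<in> U"
  shows "dtor i j k l p = e i p (tor j k l)
    - (\<Sum>m\<in>UNIV. LC.coeff i j m p * tor m k l p + LC.coeff i k m p * tor j m l p
        + LC.coeff i l m p * tor j k m p)"
proof -
  have "vfield_on \<A> U (cov nabg (e i) (e j))" for i j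
    by (rule LC.cov_vfield[OF frame_vfield frame_vfield])
  then show ?thesis
    by (simp add: dtor_def cov_form_def torsion_form_slots[OF _ assms] numeral_3_eq_3
        lessThan_Suc sum.distrib)
      (simp add: LC.coeff_def cov_def tor_def[abs_def])
qed

lemma dtor_antisym:
  assumes "p \<in> U"
  shows "dtor a i j k p = - dtor a j i k p" and "dtor a i j k p = - dtor a i k j p"
proof -
  note t = tor_antisym[OF assms]
  have "e a p (tor i j k) = e a p (\<lambda>q. - tor j i k q)" "e a p (tor i j k) = e a p (\<lambda>q. - tor i k j q)"
    by (rule tangent_cong[OF atlas frame_tangent[OF assms] assms tor_smooth], erule tor_antisym)+
  then have d: "e a p (tor i j k) = - e a p (tor j i k)" "e a p (tor i j k) = - e a p (tor i k j)"
    by (simp_all add: tangent_minus[OF atlas frame_tangent[OF assms] assms tor_smooth])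
  have 1: "LC.coeff a i m p * tor m j k p + LC.coeff a j m p * tor i m k p + LC.coeff a k m p * tor i j m p
      = - (LC.coeff a j m p * tor m i k p + LC.coeff a i m p * tor j m k p + LC.coeff a k m p * tor j i m p)" for m
    using t(1)[of j m k] t(1)[of i m k] t(1)[of i j m] by simp
  show "dtor a i j k p = - dtor a j i k p"
    unfolding dtor_eq[OF assms] d(1) 1 by (simp add: sum_negf del: minus_add_distrib)
  have 2: "LC.coeff a i m p * tor m j k p + LC.coeff a j m p * tor i m k p + LC.coeff a k m p * tor i j m p
      = - (LC.coeff a i m p * tor m k j p + LC.coeff a k m p * tor i m j p + LC.coeff a j m p * tor i k m p)" for m
    using t(2)[of m j k] t(2)[of i m k] t(2)[of i j m] by simp
  show "dtor a i j k p = - dtor a i k j p"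
    unfolding dtor_eq[OF assms] d(2) 2 by (simp add: sum_negf del: minus_add_distrib)
qed

lemma ext_d_frame:
  assumes "p \<in> U"
  shows "ext_d g nabg e (torsion_form \<A> g nab) [e i, e j, e k, e l] p
    = dtor i j k l p - dtor j i k l p + dtor k i j l p - dtor l i j k p"
proof -
  have "wedge_vec g (e s) (cov_form nabg (e s) (torsion_form \<A> g nab)) [e i, e j, e k, e l] p
      = (if s = i then dtor s j k l p else 0) - (if s = j then dtor s i k l p else 0)
      + (if s = k then dtor s i j l p else 0) - (if s = l then dtor s i j k p else 0)" for s
    by (simp add: wedge_vec_def dtor_def frame_ortho[OF assms] numeral_eq_Suc lessThan_Suc)
  then show ?thesis
    by (simp add: ext_d_def sum.distrib sum_subtractf)
qed

lemma codiff_frame: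
  "codiff nabg e (torsion_form \<A> g nab) [e j, e k] p = - (\<Sum>i\<in>UNIV. dtor i i j k p)"
  by (simp add: codiff_def interior_prod_def dtor_def)

end

section \<open>Structure equations and the first Bianchi identity\<close>

context torsion_geometry
begin

text \<open>Koszul's argument: the difference of the two connections is skew in its last two slots,
  and its skew part in the first two is the torsion. Cyclic permutations solve for it, and total
  skewness of the torsion leaves one half.\<close>

lemma coeff_eq:
  assumes "p \<in> U"
  shows "coeff i j k p = LC.coeff i j k p + tor i j k p / 2"
proof -
  note t = tor_antisym[OF assms] and c = coeff_antisym[OF assms] and l = LC.coeff_antisym[OF assms]
  have *: "tor i j k p = coeff i j k p - coeff j i k p - (LC.coeff i j k p - LC.coeff j i k p)" for i j k
    using tor_eq[OF assms] struct_eq[OF assms] by simp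
  show ?thesis
    using *[of i j k] *[of j k i] *[of k i j] t(1)[of j i k] t(2)[of j i k] t(1)[of k i j] t(2)[of i j k]
      c[of i j k] c[of j k i] c[of k i j] l[of i j k] l[of j k i] l[of k i j]
    by linarith
qed

definition riem :: "'n \<Rightarrow> 'n \<Rightarrow> 'n \<Rightarrow> 'n \<Rightarrow> 'm \<Rightarrow> real" where
  "riem i j k l p = g p (curvature \<A> nab (e i) (e j) (e k) p) (e l p)"

lemma curvature_eq:
  "curvature \<A> nab X Y Z p = (\<lambda>f. (nab p (X p) (cov nab Y Z) f - nab p (Y p) (cov nab X Z) f)
     - nab p (lie_bracket \<A> X Y p) Z f)"
  by (simp add: curvature_def cov_def)

lemma curvature_tangent:
  assumes "vfield_on \<A> U X" "vfield_on \<A> U Y" "vfield_on \<A> U Z" "p \<in> U"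
  shows "tangent \<A> p (curvature \<A> nab X Y Z p)"
  unfolding curvature_eq
  using assms
  by (intro tangent_diff_tvec nab_tangent[of U] cov_vfield lie_bracket_tangent vfield_tangent[OF atlas, of U])

lemma riem_eq:
  assumes "p \<in> U"
  shows "riem i j k l p = e i p (coeff j k l) - e j p (coeff i k l)
    - (\<Sum>m\<in>UNIV. coeff j k m p * coeff i l m p - coeff i k m p * coeff j l m p
        + struct i j m p * coeff m k l p)"
proof -
  have t: "tangent \<A> p (nab p (e i p) (cov nab (e j) (e k)))" for i j k
    by (intro nab_tangent[OF cov_vfield[OF frame_vfield frame_vfield] assms] frame_tangent assms)
  have b: "tangent \<A> p (lie_bracket \<A> (e i) (e j) p)"
    by (rule lie_bracket_tangent[OF frame_vfield frame_vfield assms])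
  have "g p (nab p (lie_bracket \<A> (e i) (e j) p) (e k)) (e l p) = (\<Sum>m\<in>UNIV. struct i j m p * coeff m k l p)"
    using nab_expand[OF assms frame_vfield b frame_tangent[OF assms]]
    by (simp add: struct_def coeff_def)
  then show ?thesis
    unfolding riem_def curvature_eq
    by (simp add: g_diff tangent_diff_tvec t b nab_tangent[OF frame_vfield assms] frame_tangent[OF assms]
        nab_nab_coeff[OF assms] sum.distrib sum_subtractf)
qed

lemma deriv_coeff_antisym:
  assumes "p \<in> U"
  shows "e a p (coeff i j k) = - e a p (coeff i k j)"
proof -
  have "e a p (coeff i j k) = e a p (\<lambda>q. - coeff i k j q)"
    by (rule tangent_cong[OF atlas frame_tangent[OF assms] assms coeff_smooth]) (erule coeff_antisym)
  then show ?thesis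
    by (simp add: tangent_minus[OF atlas frame_tangent[OF assms] assms coeff_smooth])
qed

lemma riem_antisym:
  assumes "p \<in> U"
  shows "riem i j k l p = - riem j i k l p" and "riem i j k l p = - riem i j l k p"
proof -
  have "struct i j m p = - struct j i m p" for m
    by (simp add: struct_eq[OF assms])
  then have 1: "coeff j k m p * coeff i l m p - coeff i k m p * coeff j l m p + struct i j m p * coeff m k l p
      = - (coeff i k m p * coeff j l m p - coeff j k m p * coeff i l m p + struct j i m p * coeff m k l p)" for m
    by simp
  show "riem i j k l p = - riem j i k l p"
    unfolding riem_eq[OF assms] 1 sum_negf by simp
  have 2: "coeff j k m p * coeff i l m p - coeff i k m p * coeff j l m p + struct i j m p * coeff m k l p
      = - (coeff j l m p * coeff i k m p - coeff i l m p * coeff j k m p + struct i j m p * coeff m l k p)" for m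
    using coeff_antisym[OF assms, of m k l] by simp
  show "riem i j k l p = - riem i j l k p"
    unfolding riem_eq[OF assms] 2 sum_negf
    using deriv_coeff_antisym[OF assms, of i j k l] deriv_coeff_antisym[OF assms, of j i k l] by simp
qed

text \<open>Both sides are the iterated bracket of \<open>e i\<close> with that of
  \<open>e j\<close> and \<open>e k\<close>: in frame components on the left, in third derivatives
  on the right.\<close>

lemma lie_bracket_deriv:
  assumes "p \<in> U" "smooth_at \<A> p f"
  shows "(\<Sum>l\<in>UNIV. (e i p (struct j k l) + (\<Sum>m\<in>UNIV. struct j k m p * struct i m l p)) * e l p f)
    = e i p (\<lambda>q. e j q (\<lambda>r. e k r f)) - e i p (\<lambda>q. e k q (\<lambda>r. e j r f))
    - e j p (\<lambda>q. e k q (\<lambda>r. e i r f)) + e k p (\<lambda>q. e j q (\<lambda>r. e i r f))"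
proof -
  obtain V0 where "p \<in> V0" "smooth_fun \<A> V0 f"
    using assms(2) unfolding smooth_at_def by blast
  \<comment> \<open>The fields are given on \<open>U\<close>, but \<open>f\<close> is smooth only
    near \<open>p\<close>.\<close>
  define V where "V = U \<inter> V0"
  have V: "open V" "p \<in> V" "V \<subseteq> U" and f: "smooth_fun \<A> V f"
    using \<open>p \<in> V0\<close> \<open>smooth_fun \<A> V0 f\<close> assms(1) frame_open smooth_fun_open[OF \<open>smooth_fun \<A> V0 f\<close>]
    by (auto simp: V_def intro: smooth_fun_subset[OF atlas])
  have ev: "vfield_on \<A> V (e i)" for i
    by (rule vfield_subset[OF atlas frame_vfield V(1,3)])
  have sm: "smooth_fun \<A> V h \<Longrightarrow> smooth_fun \<A> V (\<lambda>q. e i q h)" for h i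
    by (rule vfield_smooth[OF atlas ev])
  have st: "smooth_fun \<A> V (struct i j k)" for i j k
    by (rule smooth_fun_subset[OF atlas struct_smooth V(1,3)])
  note d = frame_tangent[OF assms(1)] V(2)
  have br: "lie_bracket \<A> (e j) (e k) q h = e j q (\<lambda>r. e k r h) - e k q (\<lambda>r. e j r h)"
    if "q \<in> V" "smooth_fun \<A> V h" for q h j k
    using smooth_fun_imp_at[OF that(2,1)] by (simp add: lie_bracket_def)
  have brf: "lie_bracket \<A> (e j) (e k) q h = (\<Sum>m\<in>UNIV. struct j k m q * e m q h)" if "q \<in> V" for q h j k
    using lie_bracket_frame[of q j k] that V(3) by auto
  have "e i p (\<lambda>q. e j q (\<lambda>r. e k r f)) - e i p (\<lambda>q. e k q (\<lambda>r. e j r f))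
      = e i p (\<lambda>q. e j q (\<lambda>r. e k r f) - e k q (\<lambda>r. e j r f))"
    by (rule tangent_diff[OF atlas d, symmetric]) (intro sm f)+
  also have "\<dots> = e i p (\<lambda>q. \<Sum>m\<in>UNIV. struct j k m q * e m q f)"
    by (rule tangent_cong[OF atlas d])
      (auto intro!: smooth_fun_diff[OF atlas] sm f simp: br[OF _ f, symmetric] brf)
  also have "\<dots> = (\<Sum>m\<in>UNIV. e i p (struct j k m) * e m p f + struct j k m p * e i p (\<lambda>q. e m q f))"
    by (subst tangent_sum[OF atlas d V(1)])
      (auto intro!: smooth_fun_mult[OF atlas] sm st f sum.cong tangent_mult[OF atlas d])
  finally have 1: "e i p (\<lambda>q. e j q (\<lambda>r. e k r f)) - e i p (\<lambda>q. e k q (\<lambda>r. e j r f)) = \<dots>" .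
  have 2: "e j p (\<lambda>q. e k q (\<lambda>r. e i r f)) - e k p (\<lambda>q. e j q (\<lambda>r. e i r f))
      = (\<Sum>m\<in>UNIV. struct j k m p * e m p (\<lambda>q. e i q f))"
    using br[OF V(2) sm[OF f], of j k i] brf[OF V(2)] by simp
  have "(\<Sum>m\<in>UNIV. struct j k m p * (e i p (\<lambda>q. e m q f) - e m p (\<lambda>q. e i q f)))
      = (\<Sum>m\<in>UNIV. struct j k m p * (\<Sum>l\<in>UNIV. struct i m l p * e l p f))"
    by (simp add: br[OF V(2) f, symmetric] brf[OF V(2)])
  also have "\<dots> = (\<Sum>l\<in>UNIV. (\<Sum>m\<in>UNIV. struct j k m p * struct i m l p) * e l p f)"
    unfolding sum_distrib_left sum_distrib_right by (subst sum.swap) (simp add: mult.assoc)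
  finally show ?thesis
    using 1 2 by (simp add: distrib_right sum.distrib right_diff_distrib sum_subtractf)
qed

lemma struct_jacobi:
  assumes "p \<in> U"
  shows "e i p (struct j k l) + e j p (struct k i l) + e k p (struct i j l)
    + (\<Sum>m\<in>UNIV. struct j k m p * struct i m l p + struct k i m p * struct j m l p
        + struct i j m p * struct k m l p) = 0"
proof -
  define J where "J i j k l = e i p (struct j k l) + (\<Sum>m\<in>UNIV. struct j k m p * struct i m l p)" for i j k l
  have "(\<Sum>l\<in>UNIV. (J i j k l + J j k i l + J k i j l) * e l p f) = 0" for f
  proof (cases "smooth_at \<A> p f")
    case True
    show ?thesis
      using lie_bracket_deriv[OF assms True, of i j k] lie_bracket_deriv[OF assms True, of j k i]
        lie_bracket_deriv[OF assms True, of k i j]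
      by (simp add: J_def[symmetric] distrib_right sum.distrib)
  next
    \<comment> \<open>Tangent vectors vanish on such \<open>f\<close> by convention, so the identity
      holds for all functionals' arguments and is an equality of tangent vectors.\<close>
    case False
    then have "e l p f = 0" for l
      using frame_tangent[OF assms] unfolding tangent_def by blast
    then show ?thesis by simp
  qed
  then have "J i j k l + J j k i l + J k i j l = 0"
    using g_sum_frame[OF assms, of "\<lambda>l. J i j k l + J j k i l + J k i j l" l] g_zero[OF frame_tangent[OF assms]]
    by simp
  then show ?thesis
    by (simp add: J_def sum.distrib)
qed

text \<open>In the cyclic sum the derivatives of \<open>coeff\<close> pair up to derivatives of
  \<open>struct\<close> and \<open>tor\<close>. The Jacobi identity turns the former into products,
  and the remaining quadratic identity holds for each summation index separately.\<close>

lemma bianchi: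
  assumes "p \<in> U"
  shows "riem i j k l p + riem j k i l p + riem k i j l p
    = dtor i j k l p + dtor j k i l p + dtor k i j l p
    - (\<Sum>m\<in>UNIV. tor i j m p * tor k l m p + tor j k m p * tor i l m p + tor k i m p * tor j l m p) / 2"
proof -
  have d: "e a p (coeff i j k) - e a p (coeff j i k) = e a p (struct i j k) + e a p (tor i j k)" for a i j k
  proof -
    note d = atlas frame_tangent[OF assms] assms
    have "e a p (\<lambda>q. coeff i j k q - coeff j i k q) = e a p (\<lambda>q. struct i j k q + tor i j k q)"
      by (rule tangent_cong[OF d smooth_fun_diff[OF atlas coeff_smooth coeff_smooth]])
        (simp add: tor_eq)
    then show ?thesis
      by (simp add: tangent_diff[OF d coeff_smooth coeff_smooth] tangent_add[OF d struct_smooth tor_smooth])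
  qed
  \<comment> \<open>\<open>A\<close>, \<open>B\<close> and \<open>C\<close> are the quadratic terms
    of \<open>dtor\<close>, of \<open>riem\<close> and of the Jacobi identity; \<open>D\<close> is
    the summand of \<sigma>.\<close>
  define A where "A i j k m = LC.coeff i j m p * tor m k l p + LC.coeff i k m p * tor j m l p
      + LC.coeff i l m p * tor j k m p" for i j k m
  define B where "B i j k m = coeff j k m p * coeff i l m p - coeff i k m p * coeff j l m p
      + struct i j m p * coeff m k l p" for i j k m
  define C where "C i j k m = struct j k m p * struct i m l p" for i j k m
  define D where "D m = tor i j m p * tor k l m p + tor j k m p * tor i l m p + tor k i m p * tor j l m p" for m
  note t = tor_antisym[OF assms] and lc = LC.coeff_antisym[OF assms] and ce = coeff_eq[OF assms]
    and se = struct_eq[OF assms]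
  have "B i j k m + B j k i m + B k i j m + (C i j k m + C j k i m + C k i j m)
      = A i j k m + A j k i m + A k i j m + D m / 2" for m
  proof -
    \<comment> \<open>A normal form with the summation index last, so that equal products of torsion
      components become syntactically equal.\<close>
    have T: "tor m k l p = tor k l m p" "tor m i l p = tor i l m p" "tor m j l p = tor j l m p"
      "tor j m l p = - tor j l m p" "tor k m l p = - tor k l m p" "tor i m l p = - tor i l m p"
      "tor k i m p = - tor i k m p" "tor k j m p = - tor j k m p" "tor j i m p = - tor i j m p"
      using t(1)[of m k l] t(2)[of k m l] t(1)[of m i l] t(2)[of i m l] t(1)[of m j l] t(2)[of j m l]
        t(1)[of i k m] t(1)[of j k m] t(1)[of i j m] by linarith+
    show ?thesis
      unfolding A_def B_def C_def D_def ce se T lc[of i m l] lc[of j m l] lc[of k m l]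
      by (simp add: algebra_simps add_divide_distrib diff_divide_distrib)
  qed
  then have "(\<Sum>m\<in>UNIV. B i j k m + B j k i m + B k i j m + (C i j k m + C j k i m + C k i j m))
      = (\<Sum>m\<in>UNIV. A i j k m + A j k i m + A k i j m + D m / 2)"
    by simp
  then have s: "sum (B i j k) UNIV + sum (B j k i) UNIV + sum (B k i j) UNIV
      + (sum (C i j k) UNIV + sum (C j k i) UNIV + sum (C k i j) UNIV)
      = sum (A i j k) UNIV + sum (A j k i) UNIV + sum (A k i j) UNIV + sum D UNIV / 2"
    by (simp add: sum.distrib sum_divide_distrib)
  have j: "e i p (struct j k l) + e j p (struct k i l) + e k p (struct i j l)
      + (sum (C i j k) UNIV + sum (C j k i) UNIV + sum (C k i j) UNIV) = 0"
    using struct_jacobi[OF assms, of i j k l] by (simp add: C_def[abs_def] sum.distrib)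
  show ?thesis
    unfolding riem_eq[OF assms] dtor_eq[OF assms] A_def[symmetric] B_def[symmetric] D_def[symmetric]
    using s j d[of i j k l] d[of j k i l] d[of k i j l] by linarith
qed

end

section \<open>The spinor connection\<close>

locale spinor_conn = metric_conn \<A> g U E nab + clifford_action \<gamma>
  for \<A> :: "('m::topological_space, 'n::finite) atlas" and g U E nab
    and \<gamma> :: "'n \<Rightarrow> complex ^ 's::finite \<Rightarrow> complex ^ 's"
begin

definition conn_form :: "'m \<Rightarrow> 'm tvec \<Rightarrow> 'n \<Rightarrow> 'n \<Rightarrow> real" where
  "conn_form p v i j = g p (nab p v (E i)) (E j p)"

definition cliff :: "'m \<Rightarrow> 'm tvec \<Rightarrow> complex ^ 's \<Rightarrow> complex ^ 's" where
  "cliff p w x = (\<Sum>i\<in>UNIV. g p w (E i p) *\<^sub>R \<gamma> i x)"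

text \<open>In contrast to \<open>spinor_cov\<close>, this takes a tangent vector at one point and a
  single component function, so that directions can be expanded in a frame pointwise.\<close>

definition scov :: "'m \<Rightarrow> 'm tvec \<Rightarrow> ('m \<Rightarrow> complex ^ 's) \<Rightarrow> complex ^ 's" where
  "scov p v \<psi> = vec_deriv v \<psi> + spin_rep (conn_form p v) (\<psi> p)"

lemma conn_form_antisym: "p \<in> U \<Longrightarrow> tangent \<A> p v \<Longrightarrow> conn_form p v i j = - conn_form p v j i"
  unfolding conn_form_def by (rule nab_frame_antisym)

lemma conn_form_smooth: "vfield_on \<A> U X \<Longrightarrow> smooth_fun \<A> U (\<lambda>q. conn_form q (X q) i j)"
  using g_smooth[OF cov_vfield[OF _ frame_vfield] frame_vfield] by (simp add: conn_form_def cov_def)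

lemma smooth_gamma: "smooth_fun \<A> V \<psi> \<Longrightarrow> smooth_fun \<A> V (\<lambda>q. \<gamma> i (\<psi> q))"
  by (rule smooth_fun_linear[OF atlas linear[unfolded linear_conv_bounded_linear]])

lemma spin_rep_smooth:
  assumes "\<And>i j. smooth_fun \<A> U (\<lambda>q. b q i j)" "smooth_fun \<A> U \<psi>"
  shows "smooth_fun \<A> U (\<lambda>q. spin_rep (b q) (\<psi> q))"
  unfolding spin_rep_def wsum2_def
  by (intro smooth_fun_scaleR[OF atlas] smooth_fun_const[OF atlas frame_open]
      smooth_fun_sum[OF atlas frame_open] assms(1) smooth_gamma assms(2))

lemma cliff_smooth:
  assumes "vfield_on \<A> U Z" "smooth_fun \<A> U \<psi>"
  shows "smooth_fun \<A> U (\<lambda>q. cliff q (Z q) (\<psi> q))"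
  unfolding cliff_def
  by (intro smooth_fun_scaleR[OF atlas] smooth_fun_sum[OF atlas frame_open]
      g_smooth[OF assms(1) frame_vfield] smooth_gamma assms(2))

lemma scov_smooth:
  assumes "vfield_on \<A> U X" "smooth_fun \<A> U \<psi>"
  shows "smooth_fun \<A> U (\<lambda>q. scov q (X q) \<psi>)"
  unfolding scov_def
  by (rule smooth_fun_add[OF atlas smooth_vec_deriv[OF atlas assms]
        spin_rep_smooth[OF conn_form_smooth[OF assms(1)] assms(2)]])

lemma linear_cliff: "linear (cliff p w)"
  unfolding cliff_def by (intro linear_compose_sum ballI linear_compose_scale_right linear)

lemma cliff_sum:
  assumes "\<And>i. i \<in> I \<Longrightarrow> tangent \<A> p (w i)" "p \<in> U"
  shows "cliff p (\<lambda>f. \<Sum>i\<in>I. c i * w i f) x = (\<Sum>i\<in>I. c i *\<^sub>R cliff p (w i) x)"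
  unfolding cliff_def
  using assms by (simp add: g_sum frame_tangent scaleR_sum_left scaleR_sum_right)
    (rule sum.swap)

lemma spin_rep_sum: "spin_rep (\<lambda>i j. \<Sum>k\<in>I. c k * a k i j) x = (\<Sum>k\<in>I. c k *\<^sub>R spin_rep (a k) x)"
proof -
  have "wsum2 (\<lambda>i j. \<Sum>k\<in>I. c k * a k i j) x = (\<Sum>k\<in>I. c k *\<^sub>R wsum2 (a k) x)"
  proof (induction I rule: infinite_finite_induct)
    case (insert k I)
    then show ?case by (simp add: wsum2_add wsum2_scale)
  qed (simp_all add: wsum2_def)
  then show ?thesis by (simp add: spin_rep_def scaleR_sum_right mult.commute)
qed

lemma vec_deriv_tvec_sum:
  "vec_deriv (\<lambda>f. \<Sum>i\<in>I. c i * w i f) \<psi> = (\<Sum>i\<in>I. c i *\<^sub>R vec_deriv (w i) (\<psi> :: 'm \<Rightarrow> complex ^ 's))"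
  by (simp add: vec_deriv_def vec_eq_iff complex_eq_iff)

lemma scov_sum:
  assumes "\<And>i. i \<in> I \<Longrightarrow> tangent \<A> p (w i)" "p \<in> U"
  shows "scov p (\<lambda>f. \<Sum>i\<in>I. c i * w i f) \<psi> = (\<Sum>i\<in>I. c i *\<^sub>R scov p (w i) \<psi>)"
proof -
  have "conn_form p (\<lambda>f. \<Sum>i\<in>I. c i * w i f) = (\<lambda>i j. \<Sum>k\<in>I. c k * conn_form p (w k) i j)"
    using assms by (intro ext) (simp add: conn_form_def nab_sum[OF frame_vfield] g_sum
        nab_tangent[OF frame_vfield] frame_tangent)
  then show ?thesis
    by (simp add: scov_def vec_deriv_tvec_sum spin_rep_sum scaleR_add_right sum.distrib)
qed

lemma scov_add:
  assumes "p \<in> U" "tangent \<A> p v" "smooth_fun \<A> U \<psi>" "smooth_fun \<A> U \<eta>"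
  shows "scov p v (\<lambda>q. \<psi> q + \<eta> q) = scov p v \<psi> + scov p v \<eta>"
  by (simp add: scov_def vec_deriv_add[OF atlas assms(2,1,3,4)] linear_add[OF linear_spin_rep])

lemma scov_spinor_sum:
  assumes "p \<in> U" "tangent \<A> p v" "\<And>i. i \<in> I \<Longrightarrow> smooth_fun \<A> U (\<psi> i)"
  shows "scov p v (\<lambda>q. \<Sum>i\<in>I. \<psi> i q) = (\<Sum>i\<in>I. scov p v (\<psi> i))"
  by (simp add: scov_def vec_deriv_sum[OF atlas assms(2,1) frame_open assms(3)]
      linear_sum[OF linear_spin_rep] sum.distrib)

lemma scov_cong:
  assumes "p \<in> U" "tangent \<A> p v" "smooth_fun \<A> U \<psi>" "\<And>q. q \<in> U \<Longrightarrow> \<psi> q = \<eta> q"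
  shows "scov p v \<psi> = scov p v \<eta>"
  unfolding scov_def
  using vec_deriv_cong[OF atlas assms(2,1,3), of \<eta>] assms by simp

text \<open>Differentiating the components of \<open>Z\<close> in \<open>E\<close> produces, besides
  the covariant derivative of \<open>Z\<close>, a connection term; it cancels the commutator from
  \<open>spin_rep_act\<close>.\<close>

lemma scov_cliff:
  assumes "p \<in> U" "tangent \<A> p v" "vfield_on \<A> U Z" "smooth_fun \<A> U \<psi>"
  shows "scov p v (\<lambda>q. cliff q (Z q) (\<psi> q)) = cliff p (nab p v Z) (\<psi> p) + cliff p (Z p) (scov p v \<psi>)"
proof -
  note d = atlas assms(2,1)
  let ?a = "conn_form p v"
  have gs: "smooth_fun \<A> U (\<lambda>q. g q (Z q) (E i q))" for i
    by (rule g_smooth[OF assms(3) frame_vfield])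
  have Zp: "tangent \<A> p (Z p)"
    by (rule vfield_tangent[OF atlas assms(3,1)])
  have 1: "v (\<lambda>q. g q (Z q) (E i q)) = g p (nab p v Z) (E i p) + (\<Sum>j\<in>UNIV. g p (Z p) (E j p) * ?a i j)" for i
    unfolding nab_metric[OF assms(3) frame_vfield assms(1,2)] conn_form_def
    using parseval[OF assms(1) Zp nab_tangent[OF frame_vfield assms(1,2)]] by simp
  have "vec_deriv v (\<lambda>q. cliff q (Z q) (\<psi> q)) = (\<Sum>i\<in>UNIV.
      v (\<lambda>q. g q (Z q) (E i q)) *\<^sub>R \<gamma> i (\<psi> p) + g p (Z p) (E i p) *\<^sub>R \<gamma> i (vec_deriv v \<psi>))"
    unfolding cliff_def
    by (subst vec_deriv_sum[OF d frame_open])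
      (simp_all add: vec_deriv_scaleR[OF d gs] smooth_gamma[OF assms(4)] vec_deriv_linear[OF d assms(4) linear]
        smooth_fun_scaleR[OF atlas gs])
  also have "\<dots> = cliff p (nab p v Z) (\<psi> p) + cliff p (Z p) (vec_deriv v \<psi>)
      + (\<Sum>i\<in>UNIV. \<Sum>j\<in>UNIV. (g p (Z p) (E j p) * ?a i j) *\<^sub>R \<gamma> i (\<psi> p))"
    unfolding 1 by (simp add: cliff_def scaleR_add_left sum.distrib scaleR_sum_left)
  also have "(\<Sum>i\<in>UNIV. \<Sum>j\<in>UNIV. (g p (Z p) (E j p) * ?a i j) *\<^sub>R \<gamma> i (\<psi> p))
      = (\<Sum>j\<in>UNIV. \<Sum>i\<in>UNIV. (g p (Z p) (E j p) * ?a i j) *\<^sub>R \<gamma> i (\<psi> p))"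
    by (rule sum.swap)
  also have "\<dots> = - (\<Sum>j\<in>UNIV. g p (Z p) (E j p) *\<^sub>R (\<Sum>i\<in>UNIV. ?a j i *\<^sub>R \<gamma> i (\<psi> p)))"
    unfolding sum_negf[symmetric] scaleR_sum_right
    by (intro sum.cong refl, subst conn_form_antisym[OF assms(1,2)]) simp
  finally have 2: "vec_deriv v (\<lambda>q. cliff q (Z q) (\<psi> q)) = cliff p (nab p v Z) (\<psi> p)
      + cliff p (Z p) (vec_deriv v \<psi>)
      - (\<Sum>j\<in>UNIV. g p (Z p) (E j p) *\<^sub>R (\<Sum>i\<in>UNIV. ?a j i *\<^sub>R \<gamma> i (\<psi> p)))"
    by simp
  have "spin_rep ?a (\<gamma> j (\<psi> p)) = \<gamma> j (spin_rep ?a (\<psi> p)) + (\<Sum>i\<in>UNIV. ?a j i *\<^sub>R \<gamma> i (\<psi> p))" for j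
    by (rule spin_rep_act) (rule conn_form_antisym[OF assms(1,2)])
  then have "spin_rep ?a (cliff p (Z p) (\<psi> p)) = cliff p (Z p) (spin_rep ?a (\<psi> p))
      + (\<Sum>j\<in>UNIV. g p (Z p) (E j p) *\<^sub>R (\<Sum>i\<in>UNIV. ?a j i *\<^sub>R \<gamma> i (\<psi> p)))"
    by (simp add: cliff_def linear_sum[OF linear_spin_rep] linear_cmul[OF linear_spin_rep]
        scaleR_add_right sum.distrib)
  then show ?thesis
    unfolding scov_def 2 by (simp add: linear_add[OF linear_cliff])
qed

lemma vec_deriv_spin_rep:
  assumes "p \<in> U" "tangent \<A> p v" "\<And>i j. smooth_fun \<A> U (\<lambda>q. b q i j)" "smooth_fun \<A> U \<psi>"
  shows "vec_deriv v (\<lambda>q. spin_rep (b q) (\<psi> q))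
    = spin_rep (\<lambda>i j. v (\<lambda>q. b q i j)) (\<psi> p) + spin_rep (b p) (vec_deriv v \<psi>)"
proof -
  note d = atlas assms(2,1)
  note sm = smooth_gamma smooth_fun_scaleR[OF atlas] assms(3,4) smooth_fun_sum[OF atlas frame_open]
  have 1: "vec_deriv v (\<lambda>q. b q i j *\<^sub>R \<gamma> i (\<gamma> j (\<psi> q)))
      = v (\<lambda>q. b q i j) *\<^sub>R \<gamma> i (\<gamma> j (\<psi> p)) + b p i j *\<^sub>R \<gamma> i (\<gamma> j (vec_deriv v \<psi>))" for i j
    using vec_deriv_linear[OF d smooth_gamma[OF assms(4)] linear, of i j]
      vec_deriv_linear[OF d assms(4) linear, of j]
    by (simp add: vec_deriv_scaleR[OF d assms(3) smooth_gamma[OF smooth_gamma[OF assms(4)]]])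
  have "vec_deriv v (\<lambda>q. wsum2 (b q) (\<psi> q))
      = wsum2 (\<lambda>i j. v (\<lambda>q. b q i j)) (\<psi> p) + wsum2 (b p) (vec_deriv v \<psi>)"
    unfolding wsum2_def
    by (simp add: vec_deriv_sum[OF d frame_open] sm 1 sum.distrib)
  moreover have "smooth_fun \<A> U (\<lambda>q. wsum2 (b q) (\<psi> q))"
    unfolding wsum2_def by (intro sm)
  ultimately show ?thesis
    using vec_deriv_linear[OF d, of "\<lambda>q. wsum2 (b q) (\<psi> q)" "\<lambda>x. (1/4) *\<^sub>R x"]
    by (simp add: spin_rep_def scaleR_add_right linear_scale_self linear_compose_scale_right)
qed

end

section \<open>Spinor curvature\<close>

context clifford_action
begin

lemma spin_rep_add: "spin_rep (\<lambda>i j. a i j + b i j) x = spin_rep a x + spin_rep b x"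
  and spin_rep_diff: "spin_rep (\<lambda>i j. a i j - b i j) x = spin_rep a x - spin_rep b x"
  by (simp_all add: spin_rep_def wsum2_add wsum2_diff scaleR_add_right scaleR_diff_right)

text \<open>The symmetric part of \<open>h\<close> meets only anticommutators and contributes its
  trace. This separates the Laplacian from the curvature and torsion terms.\<close>

lemma sum_act_symmetrize:
  "(\<Sum>i\<in>UNIV. \<Sum>j\<in>UNIV. c i (c j (h i j)))
    = (1/2) *\<^sub>R (\<Sum>i\<in>UNIV. \<Sum>j\<in>UNIV. c i (c j (h i j - h j i))) - (\<Sum>i\<in>UNIV. h i i)"
proof -
  let ?S = "\<lambda>h. \<Sum>i\<in>UNIV. \<Sum>j\<in>UNIV. c i (c j (h i j))"
  have "?S h = (1/2) *\<^sub>R (?S h - ?S (\<lambda>i j. h j i)) + (1/2) *\<^sub>R (?S h + ?S (\<lambda>i j. h j i))"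
    by (simp add: algebra_simps flip: scaleR_left_distrib)
  also have "?S h + ?S (\<lambda>i j. h j i) = - 2 *\<^sub>R (\<Sum>i\<in>UNIV. h i i)"
    by (rule sum_anticommute)
  finally show ?thesis
    by (simp add: act_diff sum_subtractf)
qed

end

locale spin_torsion_geometry = torsion_geometry \<A> g U e nab nabg + S: spinor_conn \<A> g U E nab \<gamma>
  for \<A> :: "('m::topological_space, 'n::finite) atlas" and g U e nab nabg E
    and \<gamma> :: "'n \<Rightarrow> complex ^ 's::finite \<Rightarrow> complex ^ 's"
begin

definition scurv :: "'m \<Rightarrow> 'm vfield \<Rightarrow> 'm vfield \<Rightarrow> ('m \<Rightarrow> complex ^ 's) \<Rightarrow> complex ^ 's" where
  "scurv p X Y \<psi> = S.scov p (X p) (\<lambda>q. S.scov q (Y q) \<psi>) - S.scov p (Y p) (\<lambda>q. S.scov q (X q) \<psi>)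
     - S.scov p (lie_bracket \<A> X Y p) \<psi>"

text \<open>All derivatives of \<psi> cancel: the mixed terms are symmetric in \<open>X\<close> and
  \<open>Y\<close>, and the second derivatives are absorbed by the bracket. One \<open>B\<close>
  serves every \<psi>; this and its skewness suffice for finding its coefficients in
  \<open>e\<close> from commutators.\<close>

lemma scurv_spin_rep:
  assumes X: "vfield_on \<A> U X" and Y: "vfield_on \<A> U Y" and p: "p \<in> U"
  obtains B where "\<And>i j. B i j = - B j i"
    and "\<And>\<psi>. smooth_fun \<A> U \<psi> \<Longrightarrow> scurv p X Y \<psi> = S.spin_rep B (\<psi> p)"
proof -
  let ?a = "\<lambda>X q. S.conn_form q (X q)"
  let ?L = "lie_bracket \<A> X Y"
  have Xp: "tangent \<A> p (X p)" and Yp: "tangent \<A> p (Y p)" and Lp: "tangent \<A> p (?L p)"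
    using vfield_tangent[OF atlas] lie_bracket_tangent X Y p by blast+
  \<comment> \<open>The curvature form of \<open>E\<close>: exterior derivative of the connection
    form on \<open>X\<close> and \<open>Y\<close>, plus the commutator in the order of
    \<open>spin_rep_commutator\<close>.\<close>
  define B where "B = (\<lambda>i j. (X p (\<lambda>q. ?a Y q i j) - Y p (\<lambda>q. ?a X q i j)) - ?a ?L p i j
    + (\<Sum>k\<in>UNIV. ?a Y p i k * ?a X p k j - ?a X p i k * ?a Y p k j))"
  have as: "?a Z p i j = - ?a Z p j i" if "tangent \<A> p (Z p)" for Z i j
    by (rule S.conn_form_antisym[OF p that])
  have ds: "v (\<lambda>q. ?a Z q i j) = - v (\<lambda>q. ?a Z q j i)" if "tangent \<A> p v" "vfield_on \<A> U Z" for v Z i j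
  proof -
    have "v (\<lambda>q. ?a Z q i j) = v (\<lambda>q. - ?a Z q j i)"
      by (rule tangent_cong[OF atlas that(1) p S.conn_form_smooth[OF that(2)]])
        (rule S.conn_form_antisym[OF _ vfield_tangent[OF atlas that(2)]])
    then show ?thesis
      by (simp add: tangent_minus[OF atlas that(1) p S.conn_form_smooth[OF that(2)]])
  qed
  show thesis
  proof (rule that)
    fix i j
    have "(\<Sum>k\<in>UNIV. ?a Y p i k * ?a X p k j - ?a X p i k * ?a Y p k j)
        = - (\<Sum>k\<in>UNIV. ?a Y p j k * ?a X p k i - ?a X p j k * ?a Y p k i)"
      unfolding sum_negf[symmetric]
    proof (rule sum.cong[OF refl])
      fix k
      show "?a Y p i k * ?a X p k j - ?a X p i k * ?a Y p k j
          = - (?a Y p j k * ?a X p k i - ?a X p j k * ?a Y p k i)"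
        using as[of X, OF Xp, of k j] as[of X, OF Xp, of i k] as[of Y, OF Yp, of i k] as[of Y, OF Yp, of k j]
        by simp
    qed
    then show "B i j = - B j i"
      unfolding B_def
      using ds[OF Xp Y, of i j] ds[OF Yp X, of i j] as[of ?L, OF Lp, of i j] by linarith
  next
    fix \<psi> :: "'m \<Rightarrow> complex ^ 's" assume \<psi>: "smooth_fun \<A> U \<psi>"
    have 1: "S.scov p v (\<lambda>q. S.scov q (Z q) \<psi>) = vec_deriv v (\<lambda>q. vec_deriv (Z q) \<psi>)
        + S.spin_rep (\<lambda>i j. v (\<lambda>q. ?a Z q i j)) (\<psi> p) + S.spin_rep (?a Z p) (vec_deriv v \<psi>)
        + S.spin_rep (S.conn_form p v) (vec_deriv (Z p) \<psi>)
        + S.spin_rep (S.conn_form p v) (S.spin_rep (?a Z p) (\<psi> p))"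
      if "tangent \<A> p v" "vfield_on \<A> U Z" for v Z
      unfolding S.scov_def
      by (simp add: vec_deriv_add[OF atlas that(1) p smooth_vec_deriv[OF atlas that(2) \<psi>]
              S.spin_rep_smooth[OF S.conn_form_smooth[OF that(2)] \<psi>]]
            S.vec_deriv_spin_rep[OF p that(1) S.conn_form_smooth[OF that(2)] \<psi>]
            linear_add[OF S.linear_spin_rep] add.assoc)
    have 2: "S.spin_rep (?a X p) (S.spin_rep (?a Y p) (\<psi> p)) - S.spin_rep (?a Y p) (S.spin_rep (?a X p) (\<psi> p))
       = S.spin_rep (\<lambda>i j. \<Sum>k\<in>UNIV. ?a Y p i k * ?a X p k j - ?a X p i k * ?a Y p k j) (\<psi> p)"
      by (rule S.spin_rep_commutator) (intro as Xp Yp)+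
    show "scurv p X Y \<psi> = S.spin_rep B (\<psi> p)"
      unfolding scurv_def B_def S.spin_rep_add S.spin_rep_diff 1[OF Xp Y] 1[OF Yp X] 2[symmetric]
      using vec_deriv_lie_bracket[OF atlas \<psi> p, of X Y]
      by (simp add: S.scov_def[of p "?L p"] algebra_simps)
  qed
qed

lemma cliff_diff:
  "tangent \<A> p v \<Longrightarrow> tangent \<A> p w \<Longrightarrow> p \<in> U \<Longrightarrow> S.cliff p (\<lambda>f. v f - w f) x = S.cliff p v x - S.cliff p w x"
  by (simp add: S.cliff_def g_diff S.frame_tangent scaleR_diff_left sum_subtractf)

text \<open>The Leibniz rule is used twice. The mixed first-order terms are symmetric in
  \<open>X\<close> and \<open>Y\<close> and cancel; the bracket terms complete the two
  curvatures.\<close>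

lemma scurv_cliff:
  assumes X: "vfield_on \<A> U X" and Y: "vfield_on \<A> U Y" and Z: "vfield_on \<A> U Z"
    and p: "p \<in> U" and \<psi>: "smooth_fun \<A> U \<psi>"
  shows "scurv p X Y (\<lambda>q. S.cliff q (Z q) (\<psi> q))
    = S.cliff p (curvature \<A> nab X Y Z p) (\<psi> p) + S.cliff p (Z p) (scurv p X Y \<psi>)"
proof -
  have 1: "S.scov p (X p) (\<lambda>q. S.scov q (Y q) (\<lambda>r. S.cliff r (Z r) (\<psi> r)))
      = S.cliff p (nab p (X p) (cov nab Y Z)) (\<psi> p) + S.cliff p (nab p (Y p) Z) (S.scov p (X p) \<psi>)
        + (S.cliff p (nab p (X p) Z) (S.scov p (Y p) \<psi>)
        + S.cliff p (Z p) (S.scov p (X p) (\<lambda>q. S.scov q (Y q) \<psi>)))"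
    if X: "vfield_on \<A> U X" and Y: "vfield_on \<A> U Y" for X Y
  proof -
    have Xp: "tangent \<A> p (X p)"
      by (rule vfield_tangent[OF atlas X p])
    have YZ: "vfield_on \<A> U (cov nab Y Z)"
      by (rule cov_vfield[OF Y Z])
    note s = S.cliff_smooth[OF YZ \<psi>] S.cliff_smooth[OF Z S.scov_smooth[OF Y \<psi>]]
    have "S.scov p (X p) (\<lambda>q. S.scov q (Y q) (\<lambda>r. S.cliff r (Z r) (\<psi> r)))
        = S.scov p (X p) (\<lambda>q. S.cliff q (cov nab Y Z q) (\<psi> q) + S.cliff q (Z q) (S.scov q (Y q) \<psi>))"
      by (rule S.scov_cong[OF p Xp S.scov_smooth[OF Y S.cliff_smooth[OF Z \<psi>]]])
        (simp add: S.scov_cliff[OF _ vfield_tangent[OF atlas Y] Z \<psi>] cov_def)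
    also have "\<dots> = S.scov p (X p) (\<lambda>q. S.cliff q (cov nab Y Z q) (\<psi> q))
        + S.scov p (X p) (\<lambda>q. S.cliff q (Z q) (S.scov q (Y q) \<psi>))"
      by (rule S.scov_add[OF p Xp s])
    finally show ?thesis
      unfolding S.scov_cliff[OF p Xp YZ \<psi>] S.scov_cliff[OF p Xp Z S.scov_smooth[OF Y \<psi>]]
      by (simp add: cov_def)
  qed
  have t: "tangent \<A> p (nab p (X p) (cov nab Y Z))" if "vfield_on \<A> U X" "vfield_on \<A> U Y" for X Y
    by (rule nab_tangent[OF cov_vfield[OF that(2) Z] p vfield_tangent[OF atlas that(1) p]])
  have L: "tangent \<A> p (lie_bracket \<A> X Y p)"
    by (rule lie_bracket_tangent[OF X Y p])
  show ?thesis
    unfolding scurv_def 1[OF X Y] 1[OF Y X] S.scov_cliff[OF p L Z \<psi>] curvature_eq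
    by (simp add: cliff_diff tangent_diff_tvec t[OF X Y] t[OF Y X] nab_tangent[OF Z p L] p
        linear_diff[OF S.linear_cliff])
qed

abbreviation "act p \<equiv> \<lambda>k. S.cliff p (e k p)"

text \<open>Parseval for each frame expanded in the other. Orthonormal rows give the Clifford
  relations of \<open>act p\<close>, orthonormal columns the recovery of spin elements.\<close>

lemma frame_change_orthogonal:
  assumes "p \<in> U"
  shows "(\<Sum>m\<in>UNIV. g p (e k p) (E m p) * g p (e l p) (E m p)) = (if k = l then 1 else 0)"
    and "(\<Sum>k\<in>UNIV. g p (e k p) (E m p) * g p (e k p) (E n p)) = (if m = n then 1 else 0)"
proof -
  note t = frame_tangent[OF assms] S.frame_tangent[OF assms]
  show "(\<Sum>m\<in>UNIV. g p (e k p) (E m p) * g p (e l p) (E m p)) = (if k = l then 1 else 0)"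
    using S.parseval[OF assms t(1) t(1), of k l] by (simp add: frame_ortho[OF assms])
  show "(\<Sum>k\<in>UNIV. g p (e k p) (E m p) * g p (e k p) (E n p)) = (if m = n then 1 else 0)"
    using parseval[OF assms t(2) t(2), of m n]
    by (simp add: S.frame_ortho[OF assms] g_sym[OF t(2) t(1)])
qed

lemma clifford_act: "p \<in> U \<Longrightarrow> clifford_action (act p)"
  unfolding S.cliff_def by (rule S.rotated_action[OF frame_change_orthogonal(1)])

lemma scurv_frame:
  assumes p: "p \<in> U" and \<psi>: "smooth_fun \<A> U \<psi>"
  shows "4 *\<^sub>R scurv p (e i) (e j) \<psi> = (\<Sum>k\<in>UNIV. \<Sum>l\<in>UNIV. riem i j k l p *\<^sub>R act p k (act p l (\<psi> p)))"
proof -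
  obtain B where B: "\<And>k l. B k l = - B l k"
    and s: "\<And>\<psi>. smooth_fun \<A> U \<psi> \<Longrightarrow> scurv p (e i) (e j) \<psi> = S.spin_rep B (\<psi> p)"
    by (rule scurv_spin_rep[OF frame_vfield[of i] frame_vfield[of j] p]) (rule that)
  have "S.spin_rep B (act p k x) - act p k (S.spin_rep B x) = (\<Sum>l\<in>UNIV. riem i j k l p *\<^sub>R act p l x)" for k x
  proof -
    \<comment> \<open>The vector \<open>x\<close> is extended by constant components; since
      curvature acts pointwise through \<open>B\<close>, this tests \<open>B\<close> on every
      vector.\<close>
    have c: "smooth_fun \<A> U (\<lambda>q. x)"
      by (rule smooth_fun_const[OF atlas frame_open])
    have t: "tangent \<A> p (curvature \<A> nab (e i) (e j) (e k) p)"
      by (rule curvature_tangent[OF frame_vfield frame_vfield frame_vfield p])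
    have "S.spin_rep B (act p k x) = S.cliff p (curvature \<A> nab (e i) (e j) (e k) p) x + act p k (S.spin_rep B x)"
      using scurv_cliff[OF frame_vfield[of i] frame_vfield[of j] frame_vfield[of k] p c]
      by (simp add: s[OF c] s[OF S.cliff_smooth[OF frame_vfield c]])
    also have "S.cliff p (curvature \<A> nab (e i) (e j) (e k) p) x = (\<Sum>l\<in>UNIV. riem i j k l p *\<^sub>R act p l x)"
      unfolding riem_def
      by (subst frame_expand[OF p t]) (rule S.cliff_sum[OF frame_tangent[OF p] p])
    finally show ?thesis by simp
  qed
  then show ?thesis
    unfolding s[OF \<psi>] S.cliff_def
    by (intro S.spin_rep_rotated[OF frame_change_orthogonal(2)[OF p] B riem_antisym(2)[OF p]])
qed

end

section \<open>The square of the Dirac operator\<close>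

context spin_torsion_geometry
begin

lemma dirac_square:
  assumes p: "p \<in> U" and \<psi>: "smooth_fun \<A> U \<psi>"
  defines "N \<equiv> \<lambda>i. S.scov p (e i p) \<psi>"
  shows "(\<Sum>i\<in>UNIV. act p i (S.scov p (e i p) (\<lambda>q. \<Sum>j\<in>UNIV. act q j (S.scov q (e j q) \<psi>))))
    = (\<Sum>i\<in>UNIV. - S.scov p (e i p) (\<lambda>q. S.scov q (e i q) \<psi>) + S.scov p (nabg p (e i p) (e i)) \<psi>)
      - (1/2) *\<^sub>R (\<Sum>k\<in>UNIV. clifford_action.wsum2 (act p) (\<lambda>i j. tor k i j p) (N k))
      + (1/8) *\<^sub>R clifford_action.wsum4 (act p) (\<lambda>i j k l. riem i j k l p) (\<psi> p)"
proof -
  interpret C: clifford_action "act p" by (rule clifford_act[OF p])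
  note ep = frame_tangent[OF p]
  define NN where "NN i j = S.scov p (e i p) (\<lambda>q. S.scov q (e j q) \<psi>)" for i j
  \<comment> \<open>The second covariant derivative of \<psi>, with the derivative along the
    covariant derivative of \<open>e j\<close> subtracted in components.\<close>
  define H where "H i j = NN i j - (\<Sum>k\<in>UNIV. coeff i j k p *\<^sub>R N k)" for i j
  have sN: "smooth_fun \<A> U (\<lambda>q. S.scov q (e j q) \<psi>)" for j
    by (rule S.scov_smooth[OF frame_vfield \<psi>])
  have nab_act: "S.cliff p (nab p (e i p) (e j)) x = (\<Sum>k\<in>UNIV. coeff i j k p *\<^sub>R act p k x)" for i j x
    unfolding coeff_def
    by (subst frame_expand[OF p nab_tangent[OF frame_vfield p ep]]) (rule S.cliff_sum[OF ep p])
  have scov_tvec: "S.scov p v \<psi> = (\<Sum>k\<in>UNIV. g p v (e k p) *\<^sub>R N k)" if "tangent \<A> p v" for v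
    unfolding N_def by (subst frame_expand[OF p that]) (rule S.scov_sum[OF ep p])
  have D: "S.scov p (e i p) (\<lambda>q. \<Sum>j\<in>UNIV. act q j (S.scov q (e j q) \<psi>))
      = (\<Sum>j\<in>UNIV. \<Sum>k\<in>UNIV. coeff i j k p *\<^sub>R act p k (N j)) + (\<Sum>j\<in>UNIV. act p j (NN i j))" for i
    by (simp add: S.scov_spinor_sum[OF p ep S.cliff_smooth[OF frame_vfield sN]]
        S.scov_cliff[OF p ep frame_vfield sN] nab_act NN_def N_def sum.distrib)
  \<comment> \<open>Skewness of \<open>coeff\<close> moves the derivative of the frame from the
    Clifford factor to the direction of differentiation; this is what turns \<open>NN\<close> into
    \<open>H\<close>.\<close>
  have D': "(\<Sum>j\<in>UNIV. \<Sum>k\<in>UNIV. coeff i j k p *\<^sub>R act p k (N j))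
      = - (\<Sum>k\<in>UNIV. act p k (\<Sum>j\<in>UNIV. coeff i k j p *\<^sub>R N j))" for i
    unfolding C.act_simps sum_negf[symmetric]
    by (subst sum.swap, intro sum.cong refl, subst coeff_antisym[OF p]) simp
  have "S.scov p (e i p) (\<lambda>q. \<Sum>j\<in>UNIV. act q j (S.scov q (e j q) \<psi>))
      = (\<Sum>j\<in>UNIV. act p j (H i j))" for i
    unfolding D D' by (simp add: H_def C.act_diff sum_subtractf)
  then have 1: "(\<Sum>i\<in>UNIV. act p i (S.scov p (e i p) (\<lambda>q. \<Sum>j\<in>UNIV. act q j (S.scov q (e j q) \<psi>))))
      = (\<Sum>i\<in>UNIV. \<Sum>j\<in>UNIV. act p i (act p j (H i j)))"
    by (simp add: C.act_sum)
  have 2: "H i j - H j i = scurv p (e i) (e j) \<psi> - (\<Sum>k\<in>UNIV. tor k i j p *\<^sub>R N k)" for i j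
  proof -
    have t: "tor k i j p = coeff i j k p - coeff j i k p - struct i j k p" for k
      using tor_eq[OF p, of i j k] tor_antisym[OF p] by metis
    have l: "S.scov p (lie_bracket \<A> (e i) (e j) p) \<psi> = (\<Sum>k\<in>UNIV. struct i j k p *\<^sub>R N k)"
      unfolding struct_def by (rule scov_tvec[OF lie_bracket_tangent[OF frame_vfield frame_vfield p]])
    show ?thesis
      unfolding scurv_def H_def NN_def t l scaleR_diff_left sum_subtractf by simp
  qed
  have "tor i i k p = 0" for i k
    using tor_antisym(1)[OF p, of i i k] by simp
  then have "H i i = NN i i - S.scov p (nabg p (e i p) (e i)) \<psi>" for i
    unfolding scov_tvec[OF LC.nab_tangent[OF frame_vfield p ep]]
    by (simp add: H_def coeff_eq[OF p] LC.coeff_def)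
  then have 3: "(\<Sum>i\<in>UNIV. - NN i i + S.scov p (nabg p (e i p) (e i)) \<psi>) = - (\<Sum>i\<in>UNIV. H i i)"
    by (simp add: sum_negf[symmetric])
  have 4: "4 *\<^sub>R (\<Sum>i\<in>UNIV. \<Sum>j\<in>UNIV. act p i (act p j (scurv p (e i) (e j) \<psi>)))
      = C.wsum4 (\<lambda>i j k l. riem i j k l p) (\<psi> p)"
    unfolding C.wsum4_def scaleR_sum_right C.act_scaleR[symmetric] scurv_frame[OF p \<psi>]
    by (simp add: C.act_simps)
  have 4: "(\<Sum>i\<in>UNIV. \<Sum>j\<in>UNIV. act p i (act p j (scurv p (e i) (e j) \<psi>)))
      = (1/4) *\<^sub>R C.wsum4 (\<lambda>i j k l. riem i j k l p) (\<psi> p)"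
    unfolding 4[symmetric] by simp
  have 5: "(\<Sum>i\<in>UNIV. \<Sum>j\<in>UNIV. act p i (act p j (\<Sum>k\<in>UNIV. tor k i j p *\<^sub>R N k)))
      = (\<Sum>k\<in>UNIV. C.wsum2 (\<lambda>i j. tor k i j p) (N k))"
    unfolding C.act_simps C.wsum2_def by (rule sum3_rotate)
  \<comment> \<open>The 1/8 is 1/2 from antisymmetrising \<open>H\<close> times 1/4 from
    \<open>scurv_frame\<close>.\<close>
  show ?thesis
    unfolding 1 C.sum_act_symmetrize[of H] 2 C.act_diff sum_subtractf 4 5 NN_def[symmetric] 3
    by (simp add: scaleR_diff_right)
qed

definition sigma :: "'m \<Rightarrow> 'n \<Rightarrow> 'n \<Rightarrow> 'n \<Rightarrow> 'n \<Rightarrow> real" where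
  "sigma p i j k l = (\<Sum>m\<in>UNIV. tor i j m p * tor k l m p + tor j k m p * tor i l m p + tor k i m p * tor j l m p)"

definition dT :: "'m \<Rightarrow> 'n \<Rightarrow> 'n \<Rightarrow> 'n \<Rightarrow> 'n \<Rightarrow> real" where
  "dT p i j k l = dtor i j k l p - dtor j i k l p + dtor k i j l p - dtor l i j k p"

lemma tor_repeat: "p \<in> U \<Longrightarrow> tor i i k p = 0" "p \<in> U \<Longrightarrow> tor i k k p = 0" "p \<in> U \<Longrightarrow> tor k i k p = 0"
  using tor_antisym(1)[of p i i k] tor_antisym(2)[of p i k k] tor_antisym(1)[of p i k k] by simp_all

lemma dtor_repeat: "p \<in> U \<Longrightarrow> dtor a i i k p = 0" "p \<in> U \<Longrightarrow> dtor a i k k p = 0" "p \<in> U \<Longrightarrow> dtor a k i k p = 0"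
  using dtor_antisym(1)[of p a i i k] dtor_antisym(2)[of p a i k k] dtor_antisym(1)[of p a i k k] by simp_all

text \<open>Serves twice: \<sigma> drops out of the contracted Bianchi identity, and the sum over
  distinct tuples in \<open>form_mult\<close> may run over all tuples.\<close>

lemma sigma_repeat:
  assumes "p \<in> U" "\<not> distinct [i, j, k, l]"
  shows "sigma p i j k l = 0"
proof -
  note t = tor_antisym[OF assms(1)] tor_repeat[OF assms(1)]
  consider "i = j" | "i = k" | "i = l" | "j = k" | "j = l" | "k = l"
    using assms(2) by auto
  then have "tor i j m p * tor k l m p + tor j k m p * tor i l m p + tor k i m p * tor j l m p = 0" for m
    by cases (use t(1)[of i k m] t(1)[of i l m] t(1)[of i j m] t(1)[of j k m] t(1)[of j l m] in \<open>auto simp: t(3-)\<close>)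
  then show ?thesis by (simp add: sigma_def)
qed

lemma dT_repeat:
  assumes "p \<in> U" "\<not> distinct [i, j, k, l]"
  shows "dT p i j k l = 0"
proof -
  note t = dtor_antisym[OF assms(1)] dtor_repeat[OF assms(1)]
  consider "i = j" | "i = k" | "i = l" | "j = k" | "j = l" | "k = l"
    using assms(2) by auto
  then show ?thesis
    by cases (use t(2)[of j i k l] t(1)[of i j k l] t(2)[of i j k l] t(1)[of i j l k] in \<open>auto simp: dT_def t(3-)\<close>)
qed

lemma wsum4_riem:
  assumes p: "p \<in> U"
  shows "clifford_action.wsum4 (act p) (\<lambda>i j k l. riem i j k l p) x
    = (1/4) *\<^sub>R clifford_action.wsum4 (act p) (dT p) x - (1/6) *\<^sub>R clifford_action.wsum4 (act p) (sigma p) x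
    - 2 *\<^sub>R clifford_action.wsum2 (act p) (\<lambda>j k. \<Sum>i\<in>UNIV. dtor i i j k p) x
    + (2 * (\<Sum>i\<in>UNIV. \<Sum>j\<in>UNIV. riem i j j i p)) *\<^sub>R x"
proof (rule clifford_action.wsum4_curvature[OF clifford_act[OF p], where P = "\<lambda>i j k l. dtor i j k l p"])
  show "riem i j k l p + riem j k i l p + riem k i j l p = dT p i j k l + dtor l i j k p - sigma p i j k l / 2"
    for i j k l
    using bianchi[OF p, of i j k l] dtor_antisym(1)[OF p, of j i k l]
    by (simp add: dT_def sigma_def)
qed (intro riem_antisym[OF p] dtor_antisym[OF p] dT_def sigma_repeat[OF p] | simp)+

end

section \<open>Clifford multiplication by matrices and by differential forms\<close>

lemma clifford_mult: "clifford \<gamma> y *v x = (\<Sum>i\<in>UNIV. (y $ i) *\<^sub>R (\<gamma> i *v x))"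
  by (simp add: clifford_def vec_eq_iff matrix_vector_mult_def sum_distrib_right scaleR_sum_right)
    (intro allI sum.swap)

lemma clifford_action_spinor_module:
  fixes \<gamma> :: "'n::finite \<Rightarrow> complex ^ 's::finite ^ 's"
  assumes "spinor_module \<gamma>"
  shows "clifford_action (\<lambda>i x. \<gamma> i *v x)"
proof (rule clifford_action.intro)
  show "linear (\<lambda>x. \<gamma> i *v x)" for i
    by (intro linearI matrix_vector_right_distrib)
      (simp add: vec_eq_iff matrix_vector_mult_def scaleR_sum_right)
  have m: "mat (- 2) *v x = - 2 *\<^sub>R x" for x :: "complex ^ 's"
  proof -
    have "(\<Sum>j\<in>UNIV. (if s = j then - 2 else 0) * x $ j) = - (2 *\<^sub>R x $ s)" for s
      by (simp add: if_distrib[of "\<lambda>r. r * _"] scaleR_conv_of_real cong: if_cong)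
    then show ?thesis by (simp add: vec_eq_iff matrix_vector_mult_def mat_def)
  qed
  show "\<gamma> i *v (\<gamma> j *v x) + \<gamma> j *v (\<gamma> i *v x) = (if i = j then - 2 *\<^sub>R x else 0)" for i j x
  proof -
    have "\<gamma> i ** \<gamma> j + \<gamma> j ** \<gamma> i = (if i = j then mat (- 2) else 0)"
      using assms unfolding spinor_module_def by blast
    then have "(\<gamma> i ** \<gamma> j + \<gamma> j ** \<gamma> i) *v x = (if i = j then - 2 *\<^sub>R x else 0)"
      using m[of x] by auto
    then show ?thesis
      by (simp add: matrix_vector_mul_assoc matrix_vector_mult_add_rdistrib)
  qed
qed

lemma sum_lists_Suc:
  fixes f :: "'a::finite list \<Rightarrow> 'b::comm_monoid_add"
  shows "(\<Sum>is | length is = Suc n. f is) = (\<Sum>i\<in>UNIV. \<Sum>is | length is = n. f (i # is))"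
proof -
  have "(\<Sum>is | length is = Suc n. f is) = (\<Sum>(i, is)\<in>UNIV \<times> {is. length is = n}. f (i # is))"
    by (rule sum.reindex_bij_witness[of _ "\<lambda>(i, is). i # is" "\<lambda>is. (hd is, tl is)"])
      (auto simp: length_Suc_conv)
  then show ?thesis by (simp add: sum.cartesian_product)
qed

lemma sum_distinct_lists:
  fixes f :: "'a::finite list \<Rightarrow> 'b::comm_monoid_add"
  assumes "\<And>is. length is = n \<Longrightarrow> \<not> distinct is \<Longrightarrow> f is = 0"
  shows "(\<Sum>is | length is = n \<and> distinct is. f is) = (\<Sum>is | length is = n. f is)"
  using assms finite_lists_length_eq[of "UNIV :: 'a set" n]
  by (intro sum.mono_neutral_left) auto

text \<open>\<open>mult\<close> ranges over all \<Phi> because \<open>foldr\<close> forms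
  intermediate spinor fields; it reduces each of them to its value at \<open>p\<close>.\<close>

lemma form_mult_2:
  fixes c :: "'n::finite \<Rightarrow> complex ^ 's::finite \<Rightarrow> complex ^ 's"
  assumes c: "clifford_action c"
    and mult: "\<And>i \<Phi>. spinor_mult g \<gamma> S (e i) \<Phi> a p = c i (\<Phi> a p)"
    and \<omega>: "\<And>i. \<omega> [e i, e i] p = 0"
  shows "form_mult g \<gamma> S e 2 \<omega> \<Psi> a p = (1/2) *\<^sub>R clifford_action.wsum2 c (\<lambda>i j. \<omega> [e i, e j] p) (\<Psi> a p)"
proof -
  let ?f = "\<lambda>is. \<omega> (map e is) p *\<^sub>R foldr (\<lambda>i. spinor_mult g \<gamma> S (e i)) is \<Psi> a p"
  have "(\<Sum>is | length is = 2 \<and> distinct is. ?f is) = (\<Sum>is | length is = 2. ?f is)"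
    by (rule sum_distinct_lists) (auto simp: \<omega> length_Suc_conv numeral_eq_Suc)
  then show ?thesis
    by (simp add: form_mult_def clifford_action.wsum2_def[OF c] numeral_eq_Suc sum_lists_Suc mult fact_numeral)
qed

lemma form_mult_4:
  fixes c :: "'n::finite \<Rightarrow> complex ^ 's::finite \<Rightarrow> complex ^ 's"
  assumes c: "clifford_action c"
    and mult: "\<And>i \<Phi>. spinor_mult g \<gamma> S (e i) \<Phi> a p = c i (\<Phi> a p)"
    and \<omega>: "\<And>i j k l. \<not> distinct [i, j, k, l] \<Longrightarrow> \<omega> [e i, e j, e k, e l] p = 0"
  shows "form_mult g \<gamma> S e 4 \<omega> \<Psi> a p
    = (1/24) *\<^sub>R clifford_action.wsum4 c (\<lambda>i j k l. \<omega> [e i, e j, e k, e l] p) (\<Psi> a p)"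
proof -
  let ?f = "\<lambda>is. \<omega> (map e is) p *\<^sub>R foldr (\<lambda>i. spinor_mult g \<gamma> S (e i)) is \<Psi> a p"
  have "?f is = 0" if len: "length is = 4" and nd: "\<not> distinct is" for "is"
  proof -
    obtain i j k l where "is = [i, j, k, l]"
      using len by (auto simp: length_Suc_conv numeral_eq_Suc)
    then show ?thesis using \<omega>[of i j k l] nd by simp
  qed
  then have "(\<Sum>is | length is = 4 \<and> distinct is. ?f is) = (\<Sum>is | length is = 4. ?f is)"
    by (rule sum_distinct_lists)
  moreover have "(\<Sum>is | length is = 4. ?f is) = clifford_action.wsum4 c (\<lambda>i j k l. \<omega> [e i, e j, e k, e l] p) (\<Psi> a p)"
    by (simp add: clifford_action.wsum4_def[OF c] numeral_eq_Suc sum_lists_Suc mult)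
  ultimately show ?thesis
    by (simp add: form_mult_def fact_numeral)
qed

context spin_torsion_geometry
begin

text \<open>The Clifford factor and the direction of differentiation change by the same orthogonal
  matrix, so the Dirac operator is also computed by \<open>e\<close>.\<close>

lemma dirac_frame_change:
  assumes p: "p \<in> U"
  shows "(\<Sum>i\<in>UNIV. S.cliff p (E i p) (S.scov p (E i p) \<psi>)) = (\<Sum>k\<in>UNIV. act p k (S.scov p (e k p) \<psi>))"
proof -
  note t = frame_tangent[OF p] S.frame_tangent[OF p]
  have "S.cliff p (E i p) x = \<gamma> i x" for i x
    by (simp add: S.cliff_def S.frame_ortho[OF p] if_distrib[of "\<lambda>r. r *\<^sub>R _"] cong: if_cong)
  moreover have "S.scov p (E i p) \<psi> = (\<Sum>k\<in>UNIV. g p (e k p) (E i p) *\<^sub>R S.scov p (e k p) \<psi>)" for i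
    by (subst frame_expand[OF p t(2)]) (simp add: S.scov_sum[OF t(1) p] g_sym[OF t(2) t(1)])
  ultimately have "(\<Sum>i\<in>UNIV. S.cliff p (E i p) (S.scov p (E i p) \<psi>))
      = (\<Sum>i\<in>UNIV. \<Sum>k\<in>UNIV. g p (e k p) (E i p) *\<^sub>R \<gamma> i (S.scov p (e k p) \<psi>))"
    by (simp add: S.act_simps)
  also have "\<dots> = (\<Sum>k\<in>UNIV. \<Sum>i\<in>UNIV. g p (e k p) (E i p) *\<^sub>R \<gamma> i (S.scov p (e k p) \<psi>))"
    by (rule sum.swap)
  finally show ?thesis by (simp add: S.cliff_def)
qed

end

theorem theorem3p1:
  fixes \<A> :: "('m::{t2_space, second_countable_topology}, 'n::finite) atlas"
    and g :: "'m \<Rightarrow> 'm tvec \<Rightarrow> 'm tvec \<Rightarrow> real"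
    and nabg nab :: "'m conn"
    and \<gamma> :: "'n \<Rightarrow> complex ^ 's::finite ^ 's"
    and S :: "('m, 'n, 's, 'a) spin_data"
    and \<Psi> :: "('m, 's, 'a) spinor"
    and W :: "'m set"
    and e :: "'n \<Rightarrow> 'm vfield"
  assumes "smooth_atlas \<A>"
    and "riemannian_metric \<A> g"
    and "levi_civita \<A> g nabg"
    and "metric_connection \<A> g nab"
    and "differential_form \<A> 3 (torsion_form \<A> g nab)"
    and "spinor_module \<gamma>"
    and "spin_structure \<A> g \<gamma> S"
    and "spinor_field \<A> S \<Psi>"
    and "orthonormal_frame \<A> g W e"
    and "a \<in> spin_index S"
    and "p \<in> W \<inter> spin_dom S a"
  shows "dirac g \<gamma> S nab (dirac g \<gamma> S nab \<Psi>) a p =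
      spinor_laplacian g \<gamma> S nabg nab e \<Psi> a p
    + (3/4) *\<^sub>R form_mult g \<gamma> S e 4 (ext_d g nabg e (torsion_form \<A> g nab)) \<Psi> a p
    - (1/2) *\<^sub>R form_mult g \<gamma> S e 4 (sigma_form \<A> g nab) \<Psi> a p
    + (1/2) *\<^sub>R form_mult g \<gamma> S e 2 (codiff nabg e (torsion_form \<A> g nab)) \<Psi> a p
    - (\<Sum>k\<in>UNIV. form_mult g \<gamma> S e 2 (interior_prod (e k) (torsion_form \<A> g nab))
                    (spinor_cov g \<gamma> S nab (e k) \<Psi>) a p)
    + (1/4 * scalar_curvature \<A> g nab e p) *\<^sub>R \<Psi> a p"
proof -
  \<comment> \<open>Both frames are defined here, and all local computations take place on this
    set.\<close>
  define U where "U = W \<inter> spin_dom S a"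
  define E where "E = spin_frame S a"
  have p: "p \<in> U" using assms(11) by (simp add: U_def)
  have E0: "orthonormal_frame \<A> g (spin_dom S a) E"
    using assms(7,10) unfolding spin_structure_def E_def by blast
  interpret R: riemannian \<A> g
    by (rule riemannian.intro[OF assms(1,2)])
  interpret OE: orthonormal \<A> g "spin_dom S a" E
    by unfold_locales (rule E0)
  interpret OW: orthonormal \<A> g W e
    by unfold_locales (rule assms(9))
  have U: "open U" "U \<subseteq> W" "U \<subseteq> spin_dom S a"
    using OE.frame_open OW.frame_open by (auto simp: U_def)
  have nabg: "metric_connection \<A> g nabg"
    using assms(3) by (simp add: levi_civita_def)
  interpret cl: clifford_action "\<lambda>i x. \<gamma> i *v x"
    by (rule clifford_action_spinor_module[OF assms(6)])
  interpret G: spin_torsion_geometry \<A> g U e nab nabg E "\<lambda>i x. \<gamma> i *v x"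
    by unfold_locales (use OW.orthonormal_subset[OF U(1,2)] OE.orthonormal_subset[OF U(1,3)] assms nabg in auto)
  have \<psi>: "smooth_fun \<A> U (\<Psi> a)"
    using assms(8,10) smooth_fun_subset[OF assms(1) _ U(1,3)] unfolding spinor_field_def by blast
  have mult: "spinor_mult g \<gamma> S Z \<Phi> a q = G.S.cliff q (Z q) (\<Phi> a q)" for Z \<Phi> q
    unfolding G.S.cliff_def by (simp add: spinor_mult_def clifford_mult E_def)
  have scov: "spinor_cov g \<gamma> S nab X \<Phi> a q = G.S.scov q (X q) (\<Phi> a)" for X \<Phi> q
    unfolding G.S.scov_def cl.spin_rep_def cl.wsum2_def G.S.conn_form_def
    by (simp add: spinor_cov_def cov_def E_def)
  have dirac: "dirac g \<gamma> S nab \<Phi> a q = (\<Sum>i\<in>UNIV. G.act q i (G.S.scov q (e i q) (\<Phi> a)))"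
    if "q \<in> U" for q \<Phi>
    unfolding dirac_def mult scov E_def[symmetric] by (rule G.dirac_frame_change[OF that])
  \<comment> \<open>The inner Dirac operator agrees with its expression in \<open>e\<close> only on
    \<open>U\<close>; smoothness of that expression lets \<open>scov_cong\<close> replace one by the
    other under the outer derivative.\<close>
  have sm: "smooth_fun \<A> U (\<lambda>q. \<Sum>i\<in>UNIV. G.act q i (G.S.scov q (e i q) (\<Psi> a)))"
    by (intro smooth_fun_sum[OF assms(1) U(1)] G.S.cliff_smooth[OF G.frame_vfield]
        G.S.scov_smooth[OF G.frame_vfield] \<psi>)
  interpret C: clifford_action "G.act p"
    by (rule G.clifford_act[OF p])
  have D: "dirac g \<gamma> S nab (dirac g \<gamma> S nab \<Psi>) a p
      = (\<Sum>i\<in>UNIV. G.act p i (G.S.scov p (e i p) (\<lambda>q. \<Sum>j\<in>UNIV. G.act q j (G.S.scov q (e j q) (\<Psi> a)))))"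
    unfolding dirac[OF p]
    using G.S.scov_cong[OF p G.frame_tangent[OF p] sm, of "dirac g \<gamma> S nab \<Psi> a"] dirac by simp
  have lap: "spinor_laplacian g \<gamma> S nabg nab e \<Psi> a p = (\<Sum>i\<in>UNIV.
      - G.S.scov p (e i p) (\<lambda>q. G.S.scov q (e i q) (\<Psi> a)) + G.S.scov p (nabg p (e i p) (e i)) (\<Psi> a))"
  proof -
    have "spinor_cov g \<gamma> S nab (e i) \<Psi> a = (\<lambda>q. G.S.scov q (e i q) (\<Psi> a))" for i
      by (intro ext) (rule scov)
    then show ?thesis by (simp add: spinor_laplacian_def scov cov_def)
  qed
  have dT: "form_mult g \<gamma> S e 4 (ext_d g nabg e (torsion_form \<A> g nab)) \<Psi> a p
      = (1/24) *\<^sub>R C.wsum4 (G.dT p) (\<Psi> a p)"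
    using form_mult_4[where c = "G.act p" and e = e and p = p and a = a, OF C.clifford_action_axioms mult, where \<omega> = "ext_d g nabg e (torsion_form \<A> g nab)" and \<Psi> = \<Psi>] G.dT_repeat[OF p]
    by (simp add: G.ext_d_frame[OF p] G.dT_def[abs_def])
  have sg: "form_mult g \<gamma> S e 4 (sigma_form \<A> g nab) \<Psi> a p
      = (1/24) *\<^sub>R C.wsum4 (G.sigma p) (\<Psi> a p)"
    using form_mult_4[where c = "G.act p" and e = e and p = p and a = a, OF C.clifford_action_axioms mult, where \<omega> = "sigma_form \<A> g nab" and \<Psi> = \<Psi>] G.sigma_repeat[OF p]
    by (simp add: G.sigma_form_frame[OF p] G.sigma_def[abs_def])
  have cd: "form_mult g \<gamma> S e 2 (codiff nabg e (torsion_form \<A> g nab)) \<Psi> a p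
      = - (1/2) *\<^sub>R C.wsum2 (\<lambda>j k. \<Sum>i\<in>UNIV. G.dtor i i j k p) (\<Psi> a p)"
    using form_mult_2[where c = "G.act p" and e = e and p = p and a = a, OF C.clifford_action_axioms mult, where \<omega> = "codiff nabg e (torsion_form \<A> g nab)" and \<Psi> = \<Psi>]
    by (simp add: G.codiff_frame G.dtor_repeat[OF p] C.wsum2_minus)
  have ip: "form_mult g \<gamma> S e 2 (interior_prod (e k) (torsion_form \<A> g nab)) (spinor_cov g \<gamma> S nab (e k) \<Psi>) a p
      = (1/2) *\<^sub>R C.wsum2 (\<lambda>i j. G.tor k i j p) (G.S.scov p (e k p) (\<Psi> a))" for k
    using form_mult_2[where c = "G.act p" and e = e and p = p and a = a, OF C.clifford_action_axioms mult, where \<omega> = "interior_prod (e k) (torsion_form \<A> g nab)"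
        and \<Psi> = "spinor_cov g \<gamma> S nab (e k) \<Psi>"]
    by (simp add: interior_prod_def G.tor_def[symmetric] G.tor_repeat[OF p] scov)
  have sc: "scalar_curvature \<A> g nab e p = (\<Sum>i\<in>UNIV. \<Sum>j\<in>UNIV. G.riem i j j i p)"
    by (simp add: scalar_curvature_def G.riem_def)
  \<comment> \<open>The constants: 1/8 times 1/4 times 24 is 3/4 for \<open>dT\<close>; 1/8 times
    1/6 times 24 is 1/2 for \<sigma>; the divergence is twice the action of the codifferential with
    opposite sign, so -2/8 becomes 1/2; and 2/8 is the 1/4 of the scalar curvature.\<close>
  show ?thesis
    unfolding D lap dT sg cd ip sc G.dirac_square[OF p \<psi>] G.wsum4_riem[OF p]
    by (simp add: algebra_simps flip: scaleR_sum_right)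
qed

end
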